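(* Let $b$ be a prime power, let $m,n,s\in\mathbb{N}$ with $n\ge m$, and let $P$ be the digital net in base $b$ with generating matrices $C_1,\dots,C_s\in\mathbb{F}_b^{n\times m}$. For any non-empty $u\subseteq\{1,\dots,s\}$ such that $C_{u,\boldsymbol{1}}$ is full row rank (where $\boldsymbol{1}=(1,\dots,1)\in\mathbb{N}_0^{|u|}$), we have $$\Gamma_u\le\frac{b^{t^*_u+|u|-1}}{(b-1)^{|u|-1}}\qquad\text{and}\qquad \Gamma_u^*=\max_{\emptyset\ne v\subseteq u}\frac{b^{t_v^*+|v|-1}}{(b-1)^{|v|-1}}.$$ In particular, if $C_{\{1,\dots,s\},\boldsymbol{1}}$ is full row rank, then $$\Gamma=\max_{\emptyset\ne u\subseteq\{1,\dots,s\}}\frac{b^{t_u^*+|u|-1}}{(b-1)^{|u|-1}}.$$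
   Context: $\mathbb{N}$ is the set of positive integers, $\mathbb{N}_0=\mathbb{N}\cup\{0\}$, $b$ is a prime power, $\mathbb{F}_b$ is the field with $b$ elements, and $\varphi:\{0,1,\dots,b-1\}\to\mathbb{F}_b$ is a fixed bijection with $\varphi(0)=0$. For a vector $\boldsymbol{k}=(k_j)_{j\in u}$ write $|\boldsymbol{k}|=\sum_{j\in u}k_j$. Digital net: for an integer $0\le h<b^m$ with $b$-adic expansion $h=\eta_0+\eta_1b+\cdots+\eta_{m-1}b^{m-1}$, set $(\xi_{1,h,j},\dots,\xi_{n,h,j})^\top=C_j(\varphi(\eta_0),\dots,\varphi(\eta_{m-1}))^\top$, $x_{h,j}=\sum_{i=1}^n\varphi^{-1}(\xi_{i,h,j})b^{-i}$, and $\boldsymbol{x}_h=(x_{h,1},\dots,x_{h,s})\in[0,1)^s$. The digital net with generating matrices $C_1,\dots,C_s$ is $P=\{\boldsymbol{x}_h\mid 0\le h<b^m\}$ (indexed by $h$, $N=b^m$ points). Matrices $C_{u,\boldsymbol{k}}$: for $u\subseteq\{1,\dots,s\}$ and $\boldsymbol{k}=(k_j)_{j\in u}\in\mathbb{N}_0^{|u|}$, $C_{u,\boldsymbol{k}}\in\mathbb{F}_b^{|\boldsymbol{k}|\times m}$ is obtained by stacking, for $j\in u$ in increasing order, the first $k_j$ rows of $C_j$; rows of $C_j$ with index larger than $n$ are taken to be zero. A matrix is full row rank if its rows are linearly independent (a matrix with no rows is full row rank). Gain coefficients of $P$: for non-empty $u\subseteq\{1,\dots,s\}$ and $\boldsymbol{k}\in\mathbb{N}_0^{|u|}$,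 $$\Gamma_{u,\boldsymbol{k}}:=\frac1N\sum_{i,i'=0}^{N-1}\prod_{j\in u}\frac{b\,\chi(\lfloor b^{k_j+1}x_{i,j}\rfloor=\lfloor b^{k_j+1}x_{i',j}\rfloor)-\chi(\lfloor b^{k_j}x_{i,j}\rfloor=\lfloor b^{k_j}x_{i',j}\rfloor)}{b-1},$$ where $\chi(A)$ is $1$ if $A$ holds and $0$ otherwise. Maximal gain coefficients: $\Gamma_u:=\max_{\boldsymbol{k}\in\mathbb{N}_0^{|u|}}\Gamma_{u,\boldsymbol{k}}$, $\Gamma_u^*:=\max_{\emptyset\ne v\subseteq u}\max_{\boldsymbol{k}\in\mathbb{N}_0^{|v|}}\Gamma_{v,\boldsymbol{k}}$, and $\Gamma:=\max_{\emptyset\ne u\subseteq\{1,\dots,s\}}\max_{\boldsymbol{k}\in\mathbb{N}_0^{|u|}}\Gamma_{u,\boldsymbol{k}}$. For non-empty $u\subseteq\{1,\dots,s\}$: $t_u^*:=m+1-\min\{|\boldsymbol{k}| : \boldsymbol{k}\in\mathbb{N}^{|u|},\ C_{u,\boldsymbol{k}}\text{ is not full row rank}\}$. *)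

theory Defs
  imports
    "HOL-Analysis.Analysis"
    "HOL-Number_Theory.Prime_Powers"
    "Jordan_Normal_Form.DL_Rank"
begin

text \<open>
  The field with \<open>b\<close> elements is a finite field type \<open>'a\<close> with \<open>CARD('a) = b\<close>. The generating
  matrices are \<open>C 1, \<dots>, C s\<close>. Matrix rows, columns and vector entries are counted from \<open>0\<close>, so the
  \<open>i\<close>-th row in the usual numbering is row \<open>i - 1\<close> here. Points are functions \<open>x :: nat \<Rightarrow> nat \<Rightarrow> real\<close>
  with \<open>x h j\<close> the \<open>j\<close>-th coordinate of the \<open>h\<close>-th point.
\<close>

definition digit_vec :: "nat \<Rightarrow> (nat \<Rightarrow> 'a) \<Rightarrow> nat \<Rightarrow> nat \<Rightarrow> 'a vec" where
  "digit_vec b \<phi> m h = vec m (\<lambda>r. \<phi> (h div b ^ r mod b))"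

definition net_point ::
  "nat \<Rightarrow> (nat \<Rightarrow> 'a::field) \<Rightarrow> nat \<Rightarrow> nat \<Rightarrow> (nat \<Rightarrow> 'a mat) \<Rightarrow> nat \<Rightarrow> nat \<Rightarrow> real" where
  "net_point b \<phi> m n C h j =
     (\<Sum>i = 1..n. real (inv_into {0..<b} \<phi> ((C j *\<^sub>v digit_vec b \<phi> m h) $ (i - 1))) / real b ^ i)"

definition gen_row :: "nat \<Rightarrow> 'a::zero mat \<Rightarrow> nat \<Rightarrow> 'a vec" where
  "gen_row m A i = (if i < dim_row A then row A i else 0\<^sub>v m)"

text \<open>The matrix \<open>C\<^bsub>u,k\<^esub>\<close>; only the values of \<open>k\<close> on \<open>u\<close> matter.\<close>

definition stacked_mat :: "nat \<Rightarrow> (nat \<Rightarrow> 'a::zero mat) \<Rightarrow> nat set \<Rightarrow> (nat \<Rightarrow> nat) \<Rightarrow> 'a mat" where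
  "stacked_mat m C u k =
     mat_of_rows m (concat (map (\<lambda>j. map (gen_row m (C j)) [0..<k j]) (sorted_list_of_set u)))"

text \<open>
  The library's linear independence is a property of sets of vectors, so repeated rows have to be
  excluded separately.
\<close>

definition full_row_rank :: "'a::field mat \<Rightarrow> bool" where
  "full_row_rank A \<longleftrightarrow> distinct (rows A) \<and>
     module.lin_indpt class_ring (module_vec TYPE('a) (dim_col A)) (set (rows A))"

definition gain_coeff ::
  "nat \<Rightarrow> nat \<Rightarrow> (nat \<Rightarrow> nat \<Rightarrow> real) \<Rightarrow> nat set \<Rightarrow> (nat \<Rightarrow> nat) \<Rightarrow> real" where
  "gain_coeff b N x u k =
     (1 / real N) * (\<Sum>i<N. \<Sum>i'<N. \<Prod>j\<in>u.
        (real b * of_bool (\<lfloor>real b ^ (k j + 1) * x i j\<rfloor> = \<lfloor>real b ^ (k j + 1) * x i' j\<rfloor>)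
          - of_bool (\<lfloor>real b ^ k j * x i j\<rfloor> = \<lfloor>real b ^ k j * x i' j\<rfloor>))
        / (real b - 1))"

text \<open>
  The index \<open>k\<close> ranges over an infinite set, but the gain coefficients take only finitely many
  values, see \<open>finite_gain_coeff_values\<close>; hence \<open>Max\<close> is a genuine maximum.
\<close>

definition max_gain :: "nat \<Rightarrow> nat \<Rightarrow> (nat \<Rightarrow> nat \<Rightarrow> real) \<Rightarrow> nat set \<Rightarrow> real" where
  "max_gain b N x u = Max (gain_coeff b N x u ` (u \<rightarrow>\<^sub>E UNIV))"

definition max_gain_star :: "nat \<Rightarrow> nat \<Rightarrow> (nat \<Rightarrow> nat \<Rightarrow> real) \<Rightarrow> nat set \<Rightarrow> real" where
  "max_gain_star b N x u = Max (max_gain b N x ` {v. v \<noteq> {} \<and> v \<subseteq> u})"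

definition max_gain_total :: "nat \<Rightarrow> nat \<Rightarrow> (nat \<Rightarrow> nat \<Rightarrow> real) \<Rightarrow> nat \<Rightarrow> real" where
  "max_gain_total b N x s = Max (max_gain b N x ` {u. u \<noteq> {} \<and> u \<subseteq> {1..s}})"

text \<open>
  \<open>Inf\<close> on \<open>nat\<close> is the least element; the set is non-empty, see \<open>ex_not_full_row_rank\<close>.
  The value is an integer since it can be negative for general \<open>u\<close>.
\<close>

definition t_star :: "nat \<Rightarrow> (nat \<Rightarrow> 'a::field mat) \<Rightarrow> nat set \<Rightarrow> int" where
  "t_star m C u = int m + 1 -
     int (Inf {\<Sum>j\<in>u. k j | k. k \<in> u \<rightarrow>\<^sub>E {1..} \<and> \<not> full_row_rank (stacked_mat m C u k)})"

definition gain_bound :: "nat \<Rightarrow> nat \<Rightarrow> (nat \<Rightarrow> 'a::field mat) \<Rightarrow> nat set \<Rightarrow> real" where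
  "gain_bound b m C u =
     real b powi (t_star m C u + int (card u) - 1) / (real b - 1) ^ (card u - 1)"

lemma finite_gain_coeff_values:
  assumes "finite u"
  shows "finite (gain_coeff b N x u ` K)"
proof -
  define D where "D = {..<N} \<times> {..<N} \<times> u"
  define B where "B = (\<lambda>k::nat \<Rightarrow> nat. restrict (\<lambda>(i, i', j).
      (\<lfloor>real b ^ (k j + 1) * x i j\<rfloor> = \<lfloor>real b ^ (k j + 1) * x i' j\<rfloor>,
       \<lfloor>real b ^ k j * x i j\<rfloor> = \<lfloor>real b ^ k j * x i' j\<rfloor>)) D)"
  define F where "F = (\<lambda>g :: nat \<times> nat \<times> nat \<Rightarrow> bool \<times> bool.
      (1 / real N) * (\<Sum>i<N. \<Sum>i'<N. \<Prod>j\<in>u.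
        (real b * of_bool (fst (g (i, i', j))) - of_bool (snd (g (i, i', j)))) / (real b - 1)))"
  have "gain_coeff b N x u k = F (B k)" for k
    unfolding gain_coeff_def F_def B_def D_def
    by (intro arg_cong2[where f = "(*)"] sum.cong prod.cong refl) simp
  moreover have "B k \<in> D \<rightarrow>\<^sub>E UNIV" for k
    unfolding B_def by auto
  ultimately have "gain_coeff b N x u ` K \<subseteq> F ` (D \<rightarrow>\<^sub>E UNIV)"
    by auto
  moreover have "finite (D \<rightarrow>\<^sub>E (UNIV :: (bool \<times> bool) set))"
    using assms unfolding D_def by (intro finite_PiE) auto
  ultimately show ?thesis
    by (meson finite_imageI finite_subset)
qed

lemma gen_row_carrier:
  assumes "A \<in> carrier_mat n m"
  shows "gen_row m A i \<in> carrier_vec m"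
  using assms unfolding gen_row_def by auto

lemma ex_not_full_row_rank:
  fixes C :: "nat \<Rightarrow> 'a::field mat"
  assumes "finite u" "u \<noteq> {}" "\<And>j. j \<in> u \<Longrightarrow> C j \<in> carrier_mat n m"
  shows "\<exists>k \<in> u \<rightarrow>\<^sub>E {1..}. \<not> full_row_rank (stacked_mat m C u k)"
proof -
  define k where "k = restrict (\<lambda>_. n + 1) u"
  let ?L = "concat (map (\<lambda>j. map (gen_row m (C j)) [0..<k j]) (sorted_list_of_set u))"
  have "set ?L \<subseteq> carrier_vec m"
    using gen_row_carrier[OF assms(3)] assms(1) by auto
  then have rows: "rows (stacked_mat m C u k) = ?L"
    unfolding stacked_mat_def by simp
  obtain j where j: "j \<in> u"
    using assms(2) by blast
  have "gen_row m (C j) n = 0\<^sub>v m"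
    using assms(3)[OF j] unfolding gen_row_def by auto
  moreover have "gen_row m (C j) n \<in> set ?L"
  proof -
    have "n \<in> set [0..<k j]"
      using j by (simp add: k_def)
    then have "gen_row m (C j) n \<in> set (map (gen_row m (C j)) [0..<k j])"
      by (metis imageI list.set_map)
    then show ?thesis
      using j assms(1) by auto
  qed
  ultimately have zero: "0\<^sub>v m \<in> set ?L"
    by simp
  interpret vec_space "TYPE('a)" m .
  have "\<not> lin_indpt (set ?L)"
  proof
    assume "lin_indpt (set ?L)"
    with \<open>set ?L \<subseteq> carrier_vec m\<close> have "0\<^sub>v m \<notin> set ?L"
      using vs_zero_lin_dep[of "set ?L"] by (simp del: set_concat)
    then show False
      using zero by contradiction
  qed
  then have "\<not> full_row_rank (stacked_mat m C u k)"
    unfolding full_row_rank_def rows by (simp add: stacked_mat_def)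
  moreover have "k \<in> u \<rightarrow>\<^sub>E {1..}"
    unfolding k_def by auto
  ultimately show ?thesis
    by blast
qed

end

theory Submission
  imports Defs "Berlekamp_Zassenhaus.Berlekamp_Type_Based"
begin

text \<open>
  Write \<open>r\<^bsub>j,i\<^esub>\<close> for the \<open>i\<close>-th row of \<open>C\<^bsub>j\<^esub>\<close>, counted from \<open>0\<close>. The first \<open>k\<close> digits of two points
  of the net agree in coordinate \<open>j\<close> iff the difference \<open>y\<close> of their digit vectors is orthogonal to
  the first \<open>k\<close> rows of \<open>C\<^bsub>j\<^esub>\<close>. The map from indices to digit vectors is a bijection onto
  \<open>\<F>\<^bsub>b\<^esub>\<^sup>m\<close>, so the double sum in a gain coefficient collapses to a single sum over \<open>y\<close>. Only
  \<open>y\<close> in the kernel \<open>V\<close> of \<open>C\<^bsub>u,k\<^esub>\<close> contribute, each with a product over \<open>j \<in> u\<close> of the values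
  \<open>K (r\<^bsub>j,k j\<^esub> \<bullet> y) / (b - 1)\<close>, where \<open>K z = b - 1\<close> for \<open>z = 0\<close> and \<open>K z = - 1\<close> otherwise.

  The function \<open>K\<close> is the sum of all nontrivial additive characters of \<open>\<F>\<^bsub>b\<^esub>\<close>, and the two facts
  that characters would be used for hold for \<open>K\<close> itself by counting: composed with a linear functional, it
  sums to zero over every line on which the functional is not constant, and its sum over \<open>w + t z\<close> with \<open>t \<noteq> 0\<close> is
  \<open>K w * K z\<close>. The second fact turns the product over \<open>u\<close> into a sum of \<open>K\<close> over linear
  combinations with nonzero coefficients, the first one evaluates this sum over \<open>V\<close>. The outcome
  (\<open>gain_coeff_eq\<close>) is \<open>\<Gamma>\<^bsub>u,k\<^esub> = \<bar>V\<bar> A / (b - 1)\<^bsup>\<bar>u\<bar>\<^esup>\<close>, where \<open>A\<close> is the number of vectors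
  \<open>a\<close>, all of whose entries are nonzero, such that \<open>\<Sum>\<^bsub>j\<in>u\<^esub> a\<^bsub>j\<^esub> r\<^bsub>j,k j\<^esub>\<close> vanishes on \<open>V\<close>.

  Let \<open>\<rho>\<close> be the least number of rows of a matrix \<open>C\<^bsub>u,k\<^esub>\<close> with all \<open>k\<^bsub>j\<^esub> \<ge> 1\<close> that is not of full row
  rank, so that \<open>t\<^sub>u\<^sup>* = m + 1 - \<rho>\<close>.

  \<^emph>\<open>Upper bound\<close> (\<open>gain_coeff_le\<close>). If \<open>A \<noteq> 0\<close>, the functionals \<open>r\<^bsub>j,k j\<^esub>\<close> on \<open>V\<close> have a rank
  \<open>r < \<bar>u\<bar>\<close>. Their common zeros \<open>W\<close> satisfy \<open>\<bar>V\<bar> = b\<^sup>r \<bar>W\<bar>\<close>, and \<open>A \<le> (b - 1)\<^bsup>\<bar>u\<bar> - r\<^esup>\<close> because a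
  relation is determined by its entries outside a basis. Moreover \<open>W\<close> lies in the kernel of a
  matrix with \<open>\<rho> - 1\<close> independent rows, whence \<open>\<bar>W\<bar> \<le> b\<^bsup>m - \<rho> + 1\<^esup>\<close>. The resulting bound grows with
  \<open>r\<close>, and \<open>r = \<bar>u\<bar> - 1\<close> gives the claim.

  \<^emph>\<open>Attainment\<close> (\<open>gain_bound_le_some_gain_coeff\<close>). For \<open>v \<subseteq> u\<close> take a relation among the rows
  of a rank deficient \<open>C\<^bsub>v,k\<^esub>\<close> with exactly \<open>\<rho>\<close> rows, and let \<open>w\<close> be the set of those \<open>j\<close> for which the
  last row taken from \<open>C\<^bsub>j\<^esub>\<close> occurs in it. By minimality \<open>k\<^bsub>j\<^esub> = 1\<close> for \<open>j \<in> v - w\<close>, so the relation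
  only involves \<open>w\<close>. It makes the relation count \<open>A\<close> for \<open>w\<close> and \<open>k - 1\<close> at least \<open>b - 1\<close>, and the
  gain coefficient of \<open>w\<close> and \<open>k - 1\<close> is then at least the bound for \<open>v\<close>. This is why equality holds
  for the maximum over all nonempty subsets.
\<close>

section \<open>A real-valued substitute for additive characters\<close>

text \<open>
  The sum of the nontrivial additive characters of the field, evaluated at \<open>z\<close>. The formula is real and needs
  no root of unity.
\<close>

definition zero_char :: "'a::{field,finite} \<Rightarrow> real" where
  "zero_char z = real CARD('a) * of_bool (z = 0) - 1"

lemma card_field_ge_2: "CARD('a::{field,finite}) \<ge> 2"
proof -
  have "card {0, 1 :: 'a} \<le> CARD('a)"
    by (intro card_mono) auto
  then show ?thesis
    by simp
qed

lemma sum_zero_char_UNIV: "(\<Sum>z\<in>UNIV. zero_char (z :: 'a::{field,finite})) = 0"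
  unfolding zero_char_def by (simp add: sum_subtractf of_bool_def flip: sum_distrib_left)

lemma sum_zero_char_line:
  fixes w z :: "'a::{field,finite}"
  shows "(\<Sum>t\<in>UNIV. zero_char (w + t * z)) = zero_char w * (real CARD('a) * of_bool (z = 0))"
proof (cases "z = 0")
  case False
  have "bij (\<lambda>t. w + t * z)"
    by (rule bij_betw_byWitness[where f' = "\<lambda>t. (t - w) / z"]) (use False in auto)
  then have "(\<Sum>t\<in>UNIV. zero_char (w + t * z)) = (\<Sum>t\<in>UNIV. zero_char (t :: 'a))"
    by (rule sum.reindex_bij_betw)
  then show ?thesis
    using False by (simp add: sum_zero_char_UNIV)
qed simp

text \<open>
  For \<open>z = 0\<close> all \<open>b - 1\<close> terms agree; for \<open>z \<noteq> 0\<close> the full line sums to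
  zero and only the removed term \<open>t = 0\<close> remains, with a minus sign. Both cases read
  \<open>K w * K z\<close>. This is the multiplicativity that replaces
  \<open>\<psi> (x + y) = \<psi> x * \<psi> y\<close>.
\<close>

lemma sum_zero_char_punctured_line:
  fixes w z :: "'a::{field,finite}"
  shows "(\<Sum>t\<in>UNIV - {0}. zero_char (w + t * z)) = zero_char w * zero_char z"
proof -
  have "(\<Sum>t\<in>UNIV - {0}. zero_char (w + t * z)) = (\<Sum>t\<in>UNIV. zero_char (w + t * z)) - zero_char w"
    by (simp add: sum_diff1)
  then show ?thesis
    unfolding sum_zero_char_line by (simp add: zero_char_def algebra_simps)
qed

text \<open>
  The common induction behind the next two sums, for coefficients from the whole field and for nonzero coefficients. The
  shift \<open>w\<close> is what the induction on \<open>u\<close> has to generalize.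
\<close>

lemma sum_PiE_iterate:
  fixes g :: "'a::{field,finite} \<Rightarrow> real" and z :: "'i \<Rightarrow> 'a"
  assumes step: "\<And>w z. (\<Sum>t\<in>T. g (w + t * z)) = g w * h z"
    and "finite u"
  shows "(\<Sum>a\<in>u \<rightarrow>\<^sub>E T. g (w + (\<Sum>j\<in>u. a j * z j))) = g w * (\<Prod>j\<in>u. h (z j))"
  using \<open>finite u\<close>
proof (induction u arbitrary: w)
  case empty
  then show ?case by simp
next
  case (insert i u)
  have "(\<Sum>a\<in>insert i u \<rightarrow>\<^sub>E T. g (w + (\<Sum>j\<in>insert i u. a j * z j)))
      = (\<Sum>(t, a)\<in>T \<times> (u \<rightarrow>\<^sub>E T). g (w + (\<Sum>j\<in>insert i u. (a(i := t)) j * z j)))"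
    unfolding PiE_insert_eq
    by (subst sum.reindex[OF inj_combinator[OF insert.hyps(2)]]) (simp add: case_prod_beta' comp_def)
  also have "\<dots> = (\<Sum>(t, a)\<in>T \<times> (u \<rightarrow>\<^sub>E T). g ((w + t * z i) + (\<Sum>j\<in>u. a j * z j)))"
  proof (intro sum.cong refl, clarify)
    fix t a
    have "(\<Sum>j\<in>u. (a(i := t)) j * z j) = (\<Sum>j\<in>u. a j * z j)"
      using insert.hyps by (intro sum.cong) auto
    then show "g (w + (\<Sum>j\<in>insert i u. (a(i := t)) j * z j)) = g ((w + t * z i) + (\<Sum>j\<in>u. a j * z j))"
      using insert.hyps by (simp add: add.assoc)
  qed
  also have "\<dots> = (\<Sum>t\<in>T. g (w + t * z i) * (\<Prod>j\<in>u. h (z j)))"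
    by (simp add: sum.cartesian_product[symmetric] insert.IH)
  also have "\<dots> = g w * (\<Prod>j\<in>insert i u. h (z j))"
    using insert.hyps by (simp add: sum_distrib_right[symmetric] step)
  finally show ?case .
qed

lemma zero_char_0 [simp]: "zero_char (0 :: 'a::{field,finite}) = real CARD('a) - 1"
  by (simp add: zero_char_def)

lemma sum_zero_char_all_coeffs:
  fixes z :: "'i \<Rightarrow> 'a::{field,finite}"
  assumes "finite u"
  shows "(\<Sum>a\<in>u \<rightarrow>\<^sub>E UNIV. zero_char (\<Sum>j\<in>u. a j * z j))
    = (real CARD('a) - 1) * real CARD('a) ^ card u * of_bool (\<forall>j\<in>u. z j = 0)"
proof -
  have "(\<Prod>j\<in>u. real CARD('a) * of_bool (z j = 0)) = real CARD('a) ^ card u * of_bool (\<forall>j\<in>u. z j = 0)"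
    using assms by (auto simp: prod.distrib of_bool_def)
  then show ?thesis
    using sum_PiE_iterate[OF sum_zero_char_line assms, of 0 z] by simp
qed

lemma sum_zero_char_nonzero_coeffs:
  fixes z :: "'i \<Rightarrow> 'a::{field,finite}"
  assumes "finite u"
  shows "(\<Sum>a\<in>u \<rightarrow>\<^sub>E UNIV - {0}. zero_char (\<Sum>j\<in>u. a j * z j))
    = (real CARD('a) - 1) * (\<Prod>j\<in>u. zero_char (z j))"
  using sum_PiE_iterate[OF sum_zero_char_punctured_line assms, of 0 z] by simp

section \<open>Functionals on a finite vector space\<close>

text \<open>
  A nonempty set of this kind is a subspace. The single operation \<open>y + t z\<close> covers addition and scaling, and
  it is the one that moves \<open>y\<close> along a line.
\<close>

definition closed_under_combos :: "nat \<Rightarrow> 'a::field vec set \<Rightarrow> bool" where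
  "closed_under_combos m V \<longleftrightarrow> V \<subseteq> carrier_vec m \<and> (\<forall>y\<in>V. \<forall>z\<in>V. \<forall>t. y + t \<cdot>\<^sub>v z \<in> V)"

definition functional_on :: "'a::field vec set \<Rightarrow> ('a vec \<Rightarrow> 'a) \<Rightarrow> bool" where
  "functional_on V f \<longleftrightarrow> (\<forall>y\<in>V. \<forall>z\<in>V. \<forall>t. f (y + t \<cdot>\<^sub>v z) = f y + t * f z)"

lemma functional_on_sum:
  assumes "\<And>j. j \<in> S \<Longrightarrow> functional_on V (f j)"
  shows "functional_on V (\<lambda>y. \<Sum>j\<in>S. a j * f j y)"
  using assms unfolding functional_on_def
  by (simp add: sum.distrib sum_distrib_left algebra_simps cong: sum.cong)

lemma functional_on_subset: "functional_on V f \<Longrightarrow> W \<subseteq> V \<Longrightarrow> functional_on W f"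
  unfolding functional_on_def by blast

lemma functional_on_scalar_prod:
  assumes "v \<in> carrier_vec m"
  shows "functional_on (carrier_vec m) (\<lambda>y. v \<bullet> y)"
  using assms unfolding functional_on_def
  by (auto simp: scalar_prod_add_distrib[where n = m] )

lemma closed_under_combos_finite:
  fixes V :: "'a::{field,finite} vec set"
  assumes "closed_under_combos m V"
  shows "finite V"
  using assms finite_subset[OF _ finite_carrier_vec] unfolding closed_under_combos_def by blast

text \<open>
  If \<open>f\<close> is nonzero at \<open>z \<in> V\<close>, translating \<open>V\<close> by the multiples of
  \<open>z\<close> leaves the sum unchanged, and averaging over these translations gives a sum over full lines, which is
  zero.
\<close>

lemma sum_zero_char_functional:
  fixes f :: "'a::{field,finite} vec \<Rightarrow> 'a"
  assumes V: "closed_under_combos m V" and f: "functional_on V f"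
  shows "(\<Sum>y\<in>V. zero_char (f y)) = (real CARD('a) - 1) * real (card V) * of_bool (\<forall>y\<in>V. f y = 0)"
proof (cases "\<forall>y\<in>V. f y = 0")
  case True
  then show ?thesis by (simp cong: sum.cong)
next
  case False
  then obtain z where z: "z \<in> V" "f z \<noteq> 0" by blast
  have carr: "y \<in> carrier_vec m" if "y \<in> V" for y
    using V that unfolding closed_under_combos_def by blast
  have shift: "(\<Sum>y\<in>V. zero_char (f y)) = (\<Sum>y\<in>V. zero_char (f y + t * f z))" for t
  proof -
    have "bij_betw (\<lambda>y. y + t \<cdot>\<^sub>v z) V V"
    proof (rule bij_betw_byWitness[where f' = "\<lambda>y. y + (- t) \<cdot>\<^sub>v z"])
      show "\<forall>y\<in>V. y + t \<cdot>\<^sub>v z + - t \<cdot>\<^sub>v z = y" "\<forall>y\<in>V. y + - t \<cdot>\<^sub>v z + t \<cdot>\<^sub>v z = y"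
        using carr z(1) by (auto intro!: eq_vecI dest!: carr)
    qed (use V z(1) in \<open>auto simp: closed_under_combos_def\<close>)
    from sum.reindex_bij_betw[OF this, of "\<lambda>y. zero_char (f y)"]
    have "(\<Sum>y\<in>V. zero_char (f y)) = (\<Sum>y\<in>V. zero_char (f (y + t \<cdot>\<^sub>v z)))" ..
    then show ?thesis
      using f z(1) by (simp add: functional_on_def cong: sum.cong)
  qed
  have "real CARD('a) * (\<Sum>y\<in>V. zero_char (f y)) = (\<Sum>t\<in>(UNIV :: 'a set). \<Sum>y\<in>V. zero_char (f y))"
    by simp
  also have "\<dots> = (\<Sum>t\<in>UNIV. \<Sum>y\<in>V. zero_char (f y + t * f z))"
    by (intro sum.cong refl shift)
  also have "\<dots> = (\<Sum>y\<in>V. \<Sum>t\<in>UNIV. zero_char (f y + t * f z))"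
    by (rule sum.swap)
  also have "\<dots> = 0"
    using z(2) by (simp add: sum_zero_char_line)
  finally have "(\<Sum>y\<in>V. zero_char (f y)) = 0"
    by simp
  then show ?thesis
    using False by simp
qed

lemma sum_of_bool_card: "finite A \<Longrightarrow> (\<Sum>x\<in>A. of_bool (P x)) = real (card {x \<in> A. P x})"
  by (simp add: of_bool_def sum.If_cases Int_def)

text \<open>
  Rank-nullity in counting form: sum \<open>K (\<Sum>\<^bsub>j\<^esub> a\<^bsub>j\<^esub> f\<^bsub>j\<^esub> y)\<close>
  over all pairs \<open>(a, y)\<close>. Fixing \<open>y\<close>, the inner sum detects the common zeros of the
  functionals; fixing \<open>a\<close>, it detects the relations among them.
\<close>

lemma card_relations_duality:
  fixes f :: "'i \<Rightarrow> 'a::{field,finite} vec \<Rightarrow> 'a"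
  assumes V: "closed_under_combos m V" and S: "finite S"
    and f: "\<And>j. j \<in> S \<Longrightarrow> functional_on V (f j)"
  shows "CARD('a) ^ card S * card {y \<in> V. \<forall>j\<in>S. f j y = 0}
    = card V * card {a \<in> S \<rightarrow>\<^sub>E UNIV. \<forall>y\<in>V. (\<Sum>j\<in>S. a j * f j y) = 0}"
proof -
  let ?q = "real CARD('a)"
  note finV = closed_under_combos_finite[OF V]
  have lin: "functional_on V (\<lambda>y. \<Sum>j\<in>S. a j * f j y)" for a
    using f by (rule functional_on_sum)
  have finE: "finite (S \<rightarrow>\<^sub>E (UNIV :: 'a set))"
    using S by (intro finite_PiE) auto
  have "(?q - 1) * (?q ^ card S * real (card {y \<in> V. \<forall>j\<in>S. f j y = 0}))
      = (\<Sum>y\<in>V. \<Sum>a\<in>S \<rightarrow>\<^sub>E UNIV. zero_char (\<Sum>j\<in>S. a j * f j y))"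
    unfolding sum_zero_char_all_coeffs[OF S] sum_distrib_left[symmetric] sum_of_bool_card[OF finV]
    by (rule mult.assoc[symmetric])
  also have "\<dots> = (\<Sum>a\<in>S \<rightarrow>\<^sub>E UNIV. \<Sum>y\<in>V. zero_char (\<Sum>j\<in>S. a j * f j y))"
    by (rule sum.swap)
  also have "\<dots> = (?q - 1) * (real (card V)
          * real (card {a \<in> S \<rightarrow>\<^sub>E UNIV. \<forall>y\<in>V. (\<Sum>j\<in>S. a j * f j y) = 0}))"
    unfolding sum_zero_char_functional[OF V lin] sum_distrib_left[symmetric]
      sum_of_bool_card[OF finE]
    by (rule mult.assoc)
  finally have "(?q - 1) * (?q ^ card S * real (card {y \<in> V. \<forall>j\<in>S. f j y = 0}))
      = (?q - 1) * (real (card V)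
          * real (card {a \<in> S \<rightarrow>\<^sub>E UNIV. \<forall>y\<in>V. (\<Sum>j\<in>S. a j * f j y) = 0}))" .
  moreover have "?q - 1 \<noteq> 0"
    using card_field_ge_2[where 'a = 'a] by linarith
  ultimately have "?q ^ card S * real (card {y \<in> V. \<forall>j\<in>S. f j y = 0})
      = real (card V) * real (card {a \<in> S \<rightarrow>\<^sub>E UNIV. \<forall>y\<in>V. (\<Sum>j\<in>S. a j * f j y) = 0})"
    by (rule mult_left_cancel[THEN iffD1, rotated])
  then show ?thesis
    unfolding of_nat_power[symmetric] of_nat_mult[symmetric] of_nat_eq_iff .
qed

text \<open>
  Expanding the product into a sum over nonzero coefficients \<open>a\<close> and summing over \<open>V\<close> first,
  only those \<open>a\<close> survive for which the combined functional vanishes on \<open>V\<close>.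
\<close>

lemma sum_prod_zero_char:
  fixes f :: "'i \<Rightarrow> 'a::{field,finite} vec \<Rightarrow> 'a"
  assumes V: "closed_under_combos m V" and S: "finite S"
    and f: "\<And>j. j \<in> S \<Longrightarrow> functional_on V (f j)"
  shows "(\<Sum>y\<in>V. \<Prod>j\<in>S. zero_char (f j y))
    = real (card V) * real (card {a \<in> S \<rightarrow>\<^sub>E UNIV - {0}. \<forall>y\<in>V. (\<Sum>j\<in>S. a j * f j y) = 0})"
proof -
  let ?q = "real CARD('a)"
  note finV = closed_under_combos_finite[OF V]
  have lin: "functional_on V (\<lambda>y. \<Sum>j\<in>S. a j * f j y)" for a
    using f by (rule functional_on_sum)
  have finE: "finite (S \<rightarrow>\<^sub>E (UNIV - {0} :: 'a set))"
    using S by (intro finite_PiE) auto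
  have "(?q - 1) * (\<Sum>y\<in>V. \<Prod>j\<in>S. zero_char (f j y))
      = (\<Sum>y\<in>V. \<Sum>a\<in>S \<rightarrow>\<^sub>E UNIV - {0}. zero_char (\<Sum>j\<in>S. a j * f j y))"
    using S by (simp add: sum_zero_char_nonzero_coeffs sum_distrib_left)
  also have "\<dots> = (\<Sum>a\<in>S \<rightarrow>\<^sub>E UNIV - {0}. \<Sum>y\<in>V. zero_char (\<Sum>j\<in>S. a j * f j y))"
    by (rule sum.swap)
  also have "\<dots> = (?q - 1) * (real (card V)
          * real (card {a \<in> S \<rightarrow>\<^sub>E UNIV - {0}. \<forall>y\<in>V. (\<Sum>j\<in>S. a j * f j y) = 0}))"
    unfolding sum_zero_char_functional[OF V lin] sum_distrib_left[symmetric]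
      sum_of_bool_card[OF finE]
    by (rule mult.assoc)
  finally have "(?q - 1) * (\<Sum>y\<in>V. \<Prod>j\<in>S. zero_char (f j y))
      = (?q - 1) * (real (card V)
          * real (card {a \<in> S \<rightarrow>\<^sub>E UNIV - {0}. \<forall>y\<in>V. (\<Sum>j\<in>S. a j * f j y) = 0}))" .
  moreover have "?q - 1 \<noteq> 0"
    using card_field_ge_2[where 'a = 'a] by linarith
  ultimately show ?thesis
    by (rule mult_left_cancel[THEN iffD1, rotated])
qed

text \<open>
  A basis of the span of the functionals, found as a subfamily of least size with the same common zeros: a functional
  occurring in a relation vanishes where the others do, so it could be dropped.
\<close>

lemma exists_independent_subfamily:
  fixes f :: "'i \<Rightarrow> 'v \<Rightarrow> 'a::field"
  assumes "finite u"
  obtains S where "S \<subseteq> u"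
    and "{y \<in> V. \<forall>j\<in>S. f j y = 0} = {y \<in> V. \<forall>j\<in>u. f j y = 0}"
    and "\<And>a j. (\<forall>y\<in>V. (\<Sum>j\<in>S. a j * f j y) = 0) \<Longrightarrow> j \<in> S \<Longrightarrow> a j = 0"
proof -
  define Z where "Z S = {y \<in> V. \<forall>j\<in>S. f j y = 0}" for S
  obtain S where S: "S \<subseteq> u" "Z S = Z u"
    and min: "\<And>T. T \<subseteq> u \<Longrightarrow> Z T = Z u \<Longrightarrow> card S \<le> card T"
  proof -
    have "\<exists>S. (S \<subseteq> u \<and> Z S = Z u) \<and> (\<forall>T. T \<subseteq> u \<and> Z T = Z u \<longrightarrow> card S \<le> card T)"
      by (rule ex_has_least_nat[where k = u]) simp
    then show thesis
      using that by auto
  qed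
  have finS: "finite S"
    using S(1) assms finite_subset by blast
  have "a j = 0" if rel: "\<forall>y\<in>V. (\<Sum>j\<in>S. a j * f j y) = 0" and j: "j \<in> S" for a j
  proof (rule ccontr)
    assume nz: "a j \<noteq> 0"
    have "f j y = 0" if "y \<in> Z (S - {j})" for y
    proof -
      have "(\<Sum>i\<in>S. a i * f i y) = a j * f j y + (\<Sum>i\<in>S - {j}. a i * f i y)"
        using finS j by (rule sum.remove)
      moreover have "(\<Sum>i\<in>S - {j}. a i * f i y) = 0"
        using that by (intro sum.neutral) (auto simp: Z_def)
      ultimately show ?thesis
        using rel nz that by (auto simp: Z_def)
    qed
    then have "Z (S - {j}) = Z u"
      unfolding S(2)[symmetric] using j by (auto simp: Z_def)
    then show False
      using min[of "S - {j}"] S(1) finS j by (metis Diff_subset card_Diff1_less leD order_trans)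
  qed
  then show ?thesis
    using that S unfolding Z_def by blast
qed

text \<open>
  The number \<open>r\<close> is the rank of the functionals on \<open>V\<close>. A relation is determined by its entries
  outside a basis \<open>S\<close>, since the difference of two relations agreeing there is a relation on
  \<open>S\<close>. The basis is a proper subfamily because some relation has no zero entry.
\<close>

lemma card_nonzero_relations_bounds:
  fixes f :: "'i \<Rightarrow> 'a::{field,finite} vec \<Rightarrow> 'a"
  assumes V: "closed_under_combos m V" and u: "finite u"
    and f: "\<And>j. j \<in> u \<Longrightarrow> functional_on V (f j)"
    and ne: "{a \<in> u \<rightarrow>\<^sub>E UNIV - {0}. \<forall>y\<in>V. (\<Sum>j\<in>u. a j * f j y) = 0} \<noteq> {}"
    and une: "u \<noteq> {}"
  obtains r where "r < card u"
    and "card V = CARD('a) ^ r * card {y \<in> V. \<forall>j\<in>u. f j y = 0}"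
    and "card {a \<in> u \<rightarrow>\<^sub>E UNIV - {0}. \<forall>y\<in>V. (\<Sum>j\<in>u. a j * f j y) = 0}
      \<le> (CARD('a) - 1) ^ (card u - r)"
proof -
  let ?A = "{a \<in> u \<rightarrow>\<^sub>E UNIV - {0}. \<forall>y\<in>V. (\<Sum>j\<in>u. a j * f j y) = 0}"
  obtain S where S: "S \<subseteq> u"
    and zeros: "{y \<in> V. \<forall>j\<in>S. f j y = 0} = {y \<in> V. \<forall>j\<in>u. f j y = 0}"
    and indep: "\<And>a j. (\<forall>y\<in>V. (\<Sum>j\<in>S. a j * f j y) = 0) \<Longrightarrow> j \<in> S \<Longrightarrow> a j = 0"
    using exists_independent_subfamily[OF u, of V f] by blast
  have finS: "finite S"
    using S u finite_subset by blast
  have "S \<noteq> u"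
    using ne indep une by blast
  then have r: "card S < card u"
    using S u by (simp add: psubset_card_mono psubset_eq)
  have "{a \<in> S \<rightarrow>\<^sub>E UNIV. \<forall>y\<in>V. (\<Sum>j\<in>S. a j * f j y) = 0} = {restrict (\<lambda>_. 0) S}"
  proof (intro equalityI subsetI)
    fix a assume a: "a \<in> {a \<in> S \<rightarrow>\<^sub>E UNIV. \<forall>y\<in>V. (\<Sum>j\<in>S. a j * f j y) = 0}"
    then have "a j = restrict (\<lambda>_. 0) S j" for j
      using indep[of a j] PiE_arb[of a S "\<lambda>_. UNIV" j] by (cases "j \<in> S") auto
    then have "a = restrict (\<lambda>_. 0) S" ..
    then show "a \<in> {restrict (\<lambda>_. 0) S}" by simp
  qed auto
  then have card_V: "card V = CARD('a) ^ card S * card {y \<in> V. \<forall>j\<in>u. f j y = 0}"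
    using card_relations_duality[OF V finS, of f] f S zeros by (simp add: subset_iff)
  have "inj_on (\<lambda>a. restrict a (u - S)) ?A"
  proof (rule inj_onI)
    fix a a' assume a: "a \<in> ?A" and a': "a' \<in> ?A" and eq: "restrict a (u - S) = restrict a' (u - S)"
    have out: "a j = a' j" if "j \<in> u - S" for j
      using eq that by (metis restrict_apply')
    have "(\<Sum>j\<in>S. (a j - a' j) * f j y) = 0" if y: "y \<in> V" for y
    proof -
      have "(\<Sum>j\<in>S. (a j - a' j) * f j y) = (\<Sum>j\<in>u. (a j - a' j) * f j y)"
        using S u out by (intro sum.mono_neutral_left) auto
      also have "\<dots> = 0"
        using a a' y by (simp add: left_diff_distrib sum_subtractf)
      finally show ?thesis .
    qed
    then have "a j = a' j" if "j \<in> S" for j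
      using indep[of "\<lambda>j. a j - a' j" j] that by simp
    then show "a = a'"
      using out a a' by (intro extensionalityI[of a u]) (auto simp: PiE_def)
  qed
  moreover have "(\<lambda>a. restrict a (u - S)) ` ?A \<subseteq> (u - S) \<rightarrow>\<^sub>E UNIV - {0}"
    using S by (auto simp: PiE_iff restrict_def extensional_def split: if_splits)
  moreover have "finite ((u - S) \<rightarrow>\<^sub>E (UNIV - {0 :: 'a}))"
    using u by (intro finite_PiE) auto
  ultimately have "card ?A \<le> card ((u - S) \<rightarrow>\<^sub>E (UNIV - {0 :: 'a}))"
    using card_inj_on_le by blast
  also have "\<dots> = (CARD('a) - 1) ^ (card u - card S)"
    using u S finS by (simp add: card_PiE card_Diff_subset)
  finally show ?thesis
    using that[OF r card_V] by blast
qed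

text \<open>
  The \<open>b - 1\<close> nonzero multiples of a relation are relations.
\<close>

lemma card_nonzero_relations_ge:
  fixes f :: "'i \<Rightarrow> 'v \<Rightarrow> 'a::{field,finite}"
  assumes u: "finite u" "u \<noteq> {}"
    and a: "\<And>j. j \<in> u \<Longrightarrow> a j \<noteq> 0" "\<And>y. y \<in> V \<Longrightarrow> (\<Sum>j\<in>u. a j * f j y) = 0"
  shows "CARD('a) - 1 \<le> card {a \<in> u \<rightarrow>\<^sub>E UNIV - {0}. \<forall>y\<in>V. (\<Sum>j\<in>u. a j * f j y) = 0}"
    (is "_ \<le> card ?A")
proof -
  let ?g = "\<lambda>c. restrict (\<lambda>j. c * a j) u"
  have "inj_on ?g (UNIV - {0})"
    using u(2) a(1) by (intro inj_onI) (metis all_not_in_conv mult_right_cancel restrict_apply')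
  moreover have "?g ` (UNIV - {0}) \<subseteq> ?A"
    using a by (auto simp: mult.assoc simp flip: sum_distrib_left)
  moreover have "finite ?A"
    using u by (intro finite_subset[OF _ finite_PiE[of u "\<lambda>_. UNIV"]]) auto
  ultimately have "card (UNIV - {0 :: 'a}) \<le> card ?A"
    using card_inj_on_le by blast
  then show ?thesis by simp
qed

section \<open>Kernels of families of vectors\<close>

definition family_kernel :: "nat \<Rightarrow> ('i \<Rightarrow> 'a::field vec) \<Rightarrow> 'i set \<Rightarrow> 'a vec set" where
  "family_kernel m r I = {y \<in> carrier_vec m. \<forall>p\<in>I. r p \<bullet> y = 0}"

definition family_relation :: "nat \<Rightarrow> ('i \<Rightarrow> 'a::field vec) \<Rightarrow> 'i set \<Rightarrow> ('i \<Rightarrow> 'a) \<Rightarrow> bool" where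
  "family_relation m r I a \<longleftrightarrow> (\<forall>c<m. (\<Sum>p\<in>I. a p * r p $ c) = 0)"

definition family_indep :: "nat \<Rightarrow> ('i \<Rightarrow> 'a::field vec) \<Rightarrow> 'i set \<Rightarrow> bool" where
  "family_indep m r I \<longleftrightarrow> (\<forall>a. family_relation m r I a \<longrightarrow> (\<forall>p\<in>I. a p = 0))"

lemma closed_under_combos_kernel:
  assumes "\<And>p. p \<in> I \<Longrightarrow> r p \<in> carrier_vec m"
  shows "closed_under_combos m (family_kernel m r I)"
proof -
  have "r p \<bullet> (y + t \<cdot>\<^sub>v z) = r p \<bullet> y + t * (r p \<bullet> z)"
    if "p \<in> I" "y \<in> carrier_vec m" "z \<in> carrier_vec m" for p y z t
    using functional_on_scalar_prod[OF assms[OF that(1)]] that unfolding functional_on_def by blast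
  then show ?thesis
    unfolding closed_under_combos_def family_kernel_def by auto
qed

lemma closed_under_combos_carrier: "closed_under_combos m (carrier_vec m)"
  unfolding closed_under_combos_def by auto

text \<open>
  A linear combination of vectors is zero iff it is zero as a functional; unit vectors give the direction from right to
  left.
\<close>

lemma family_relation_iff:
  assumes "\<And>p. p \<in> I \<Longrightarrow> r p \<in> carrier_vec m"
  shows "family_relation m r I a \<longleftrightarrow> (\<forall>y\<in>carrier_vec m. (\<Sum>p\<in>I. a p * (r p \<bullet> y)) = 0)"
proof
  assume rel: "family_relation m r I a"
  show "\<forall>y\<in>carrier_vec m. (\<Sum>p\<in>I. a p * (r p \<bullet> y)) = 0"
  proof
    fix y :: "'b vec" assume y: "y \<in> carrier_vec m"
    have "(\<Sum>p\<in>I. a p * (r p \<bullet> y)) = (\<Sum>p\<in>I. \<Sum>c<m. a p * r p $ c * y $ c)"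
      using y by (simp add: scalar_prod_def sum_distrib_left mult.assoc lessThan_atLeast0)
    also have "\<dots> = (\<Sum>c<m. (\<Sum>p\<in>I. a p * r p $ c) * y $ c)"
      by (subst sum.swap) (simp add: sum_distrib_right)
    also have "\<dots> = 0"
      using rel by (simp add: family_relation_def)
    finally show "(\<Sum>p\<in>I. a p * (r p \<bullet> y)) = 0" .
  qed
next
  assume vanish: "\<forall>y\<in>carrier_vec m. (\<Sum>p\<in>I. a p * (r p \<bullet> y)) = 0"
  show "family_relation m r I a"
    unfolding family_relation_def
  proof (intro allI impI)
    fix c assume c: "c < m"
    have "(\<Sum>p\<in>I. a p * (r p \<bullet> unit_vec m c)) = (\<Sum>p\<in>I. a p * r p $ c)"
      using assms c by (intro sum.cong) auto
    then show "(\<Sum>p\<in>I. a p * r p $ c) = 0"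
      using vanish by simp
  qed
qed

lemma card_kernel_duality:
  fixes r :: "'i \<Rightarrow> 'a::{field,finite} vec"
  assumes "finite I" and r: "\<And>p. p \<in> I \<Longrightarrow> r p \<in> carrier_vec m"
  shows "CARD('a) ^ card I * card (family_kernel m r I)
    = CARD('a) ^ m * card {a \<in> I \<rightarrow>\<^sub>E UNIV. family_relation m r I a}"
  using card_relations_duality[OF closed_under_combos_carrier assms(1) functional_on_scalar_prod[OF r]]
  by (simp add: family_kernel_def family_relation_iff[OF r] card_carrier_vec)

lemma card_kernel_indep:
  fixes r :: "'i \<Rightarrow> 'a::{field,finite} vec"
  assumes "finite I" and r: "\<And>p. p \<in> I \<Longrightarrow> r p \<in> carrier_vec m" and ind: "family_indep m r I"
  shows "CARD('a) ^ card I * card (family_kernel m r I) = CARD('a) ^ m"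
proof -
  have "{a \<in> I \<rightarrow>\<^sub>E UNIV. family_relation m r I a} = {restrict (\<lambda>_. 0) I}"
  proof (intro equalityI subsetI)
    fix a assume a: "a \<in> {a \<in> I \<rightarrow>\<^sub>E UNIV. family_relation m r I a}"
    then have "a = restrict (\<lambda>_. 0) I"
      using ind unfolding family_indep_def by (intro extensionalityI[of a I]) (auto simp: PiE_def)
    then show "a \<in> {restrict (\<lambda>_. 0) I}" by simp
  qed (auto simp: family_relation_def)
  then show ?thesis
    using card_kernel_duality[OF assms(1) r] by simp
qed

text \<open>
  The zero relation always exists, so dependent rows can only enlarge the kernel.
\<close>

lemma card_kernel_ge:
  fixes r :: "'i \<Rightarrow> 'a::{field,finite} vec"
  assumes "finite I" and r: "\<And>p. p \<in> I \<Longrightarrow> r p \<in> carrier_vec m"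
  shows "CARD('a) ^ m \<le> CARD('a) ^ card I * card (family_kernel m r I)"
proof -
  have "restrict (\<lambda>_. 0) I \<in> {a \<in> I \<rightarrow>\<^sub>E UNIV. family_relation m r I a}"
    by (auto simp: family_relation_def)
  moreover have "finite {a \<in> I \<rightarrow>\<^sub>E (UNIV :: 'a set). family_relation m r I a}"
    using assms(1) by (intro finite_subset[OF _ finite_PiE[of I "\<lambda>_. UNIV"]]) auto
  ultimately have "0 < card {a \<in> I \<rightarrow>\<^sub>E UNIV. family_relation m r I a}"
    using card_gt_0_iff by blast
  then show ?thesis
    using card_kernel_duality[of I r m] assms by simp
qed

text \<open>
  A relation on \<open>I\<close> extends by zero to \<open>J\<close>.
\<close>

lemma family_indep_subset:
  assumes ind: "family_indep m r J" and "I \<subseteq> J" "finite J"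
  shows "family_indep m r I"
  unfolding family_indep_def
proof (intro allI impI ballI)
  fix a p assume rel: "family_relation m r I a" and p: "p \<in> I"
  have "(\<Sum>q\<in>J. (if q \<in> I then a q else 0) * r q $ c) = (\<Sum>q\<in>I. a q * r q $ c)" for c
    using \<open>I \<subseteq> J\<close> \<open>finite J\<close> by (intro sum.mono_neutral_cong_right) auto
  then have "family_relation m r J (\<lambda>q. if q \<in> I then a q else 0)"
    using rel by (simp add: family_relation_def)
  then have "(if p \<in> I then a p else 0) = 0"
    using ind p \<open>I \<subseteq> J\<close> unfolding family_indep_def by blast
  then show "a p = 0"
    using p by simp
qed

lemma family_relation_restrict:
  assumes rel: "family_relation m r I a" and "finite I" "J \<subseteq> I" and zero: "\<And>p. p \<in> I - J \<Longrightarrow> a p = 0"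
  shows "family_relation m r J a"
proof -
  have "(\<Sum>p\<in>J. a p * r p $ c) = (\<Sum>p\<in>I. a p * r p $ c)" for c
    using assms(2-4) by (intro sum.mono_neutral_left) auto
  then show ?thesis
    using rel by (simp add: family_relation_def)
qed

section \<open>Full row rank as linear independence of a family\<close>

definition row_positions :: "nat set \<Rightarrow> (nat \<Rightarrow> nat) \<Rightarrow> (nat \<times> nat) set" where
  "row_positions u k = (SIGMA j:u. {..<k j})"

definition gen_rows :: "nat \<Rightarrow> (nat \<Rightarrow> 'a::zero mat) \<Rightarrow> nat \<times> nat \<Rightarrow> 'a vec" where
  "gen_rows m C = (\<lambda>(j, i). gen_row m (C j) i)"

text \<open>
  Links independence of a set of vectors to independence of an indexed family. The index keeps track of which matrix a row
  comes from, which the set of rows forgets. A repetition \<open>r p = r q\<close> yields the relation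
  \<open>r p - r q = 0\<close>; without repetitions coefficients can be carried over along \<open>r\<close>.
\<close>

lemma distinct_lin_indpt_iff:
  fixes r :: "'i \<Rightarrow> 'a::field vec"
  assumes "distinct ps" and I: "set ps = I" and r: "\<And>p. p \<in> I \<Longrightarrow> r p \<in> carrier_vec m"
  shows "distinct (map r ps) \<and> module.lin_indpt class_ring (module_vec TYPE('a) m) (r ` I)
    \<longleftrightarrow> family_indep m r I"
proof -
  interpret vec_space "TYPE('a)" m .
  have finI: "finite I"
    using I by auto
  have dist: "distinct (map r ps) \<longleftrightarrow> inj_on r I"
    using assms(1) I by (simp add: distinct_map)
  show ?thesis
  proof (intro iffI conjI)
    assume *: "distinct (map r ps) \<and> lin_indpt (r ` I)"
    show "family_indep m r I"
      unfolding family_indep_def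
    proof (intro allI impI ballI)
      fix a p assume rel: "family_relation m r I a" and p: "p \<in> I"
      define a' where "a' v = a (the_inv_into I r v)" for v
      have inj: "inj_on r I"
        using * dist by blast
      have carr: "r ` I \<subseteq> carrier_vec m"
        using r by auto
      have "lincomb a' (r ` I) = 0\<^sub>v m"
      proof (rule eq_vecI)
        fix c assume "c < dim_vec (0\<^sub>v m :: 'a vec)"
        then have c: "c < m" by simp
        have "lincomb a' (r ` I) $ c = (\<Sum>q\<in>I. a q * r q $ c)"
          unfolding lincomb_index[OF c carr]
          by (simp add: sum.reindex[OF inj] a'_def the_inv_into_f_f[OF inj])
        then show "lincomb a' (r ` I) $ c = (0\<^sub>v m :: 'a vec) $ c"
          using rel c by (simp add: family_relation_def)
      qed (use lincomb_dim[of "r ` I" a'] carr finI in auto)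
      then have "a' \<in> r ` I \<rightarrow> {0}"
        using not_lindepD[of "r ` I" "r ` I" a'] * finI by auto
      then have "a' (r p) = 0"
        using p by blast
      then show "a p = 0"
        using p by (simp add: a'_def the_inv_into_f_f[OF inj])
    qed
  next
    assume ind: "family_indep m r I"
    show "distinct (map r ps)"
      unfolding dist
    proof (rule inj_onI, rule ccontr)
      fix p q assume pq: "p \<in> I" "q \<in> I" "r p = r q" "p \<noteq> q"
      define a :: "'i \<Rightarrow> 'a" where "a = (\<lambda>x. (if x = p then 1 else 0) - (if x = q then 1 else 0))"
      have "(\<Sum>x\<in>I. a x * r x $ c) = 0" for c
      proof -
        have "(\<Sum>x\<in>I. a x * r x $ c)
            = (\<Sum>x\<in>I. (if x = p then r x $ c else 0) - (if x = q then r x $ c else 0))"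
          by (intro sum.cong) (auto simp: a_def)
        then show ?thesis
          using finI pq by (simp add: sum_subtractf)
      qed
      then have "a p = 0"
        using ind pq(1) unfolding family_indep_def family_relation_def by blast
      then show False
        using pq(4) by (simp add: a_def)
    qed
    then have inj: "inj_on r I"
      unfolding dist .
    show "lin_indpt (r ` I)"
    proof
      assume "lin_dep (r ` I)"
      then obtain A a v where A: "finite A" "A \<subseteq> r ` I" "lincomb a A = 0\<^sub>v m" "v \<in> A" "a v \<noteq> 0"
        unfolding lin_dep_def by auto
      have carr: "A \<subseteq> carrier_vec m"
        using A(2) r by auto
      define a' where "a' p = (if r p \<in> A then a (r p) else 0)" for p
      have "(\<Sum>p\<in>I. a' p * r p $ c) = 0" if c: "c < m" for c
      proof -
        have "(\<Sum>p\<in>I. a' p * r p $ c) = (\<Sum>w\<in>r ` I. (if w \<in> A then a w else 0) * w $ c)"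
          by (simp add: sum.reindex[OF inj] a'_def)
        also have "\<dots> = (\<Sum>w\<in>A. a w * w $ c)"
          using finI A(2) by (intro sum.mono_neutral_cong_right) auto
        also have "\<dots> = lincomb a A $ c"
          by (simp add: lincomb_index[OF c carr])
        finally show ?thesis
          using A(3) c by simp
      qed
      then have "\<forall>p\<in>I. a' p = 0"
        using ind unfolding family_indep_def family_relation_def by blast
      moreover obtain p where "p \<in> I" "v = r p"
        using A(2,4) by blast
      ultimately show False
        using A(4,5) by (auto simp: a'_def)
    qed
  qed
qed

lemma full_row_rank_iff:
  fixes C :: "nat \<Rightarrow> 'a::field mat"
  assumes "finite u" and C: "\<And>j. j \<in> u \<Longrightarrow> C j \<in> carrier_mat n m"
  shows "full_row_rank (stacked_mat m C u k) \<longleftrightarrow> family_indep m (gen_rows m C) (row_positions u k)"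
proof -
  define ps where "ps = concat (map (\<lambda>j. map (Pair j) [0..<k j]) (sorted_list_of_set u))"
  have "distinct (concat (map (\<lambda>j. map (Pair j) [0..<k j]) xs))" if "distinct xs" for xs :: "nat list"
    using that by (induction xs) (auto simp: distinct_map inj_on_def)
  then have dist: "distinct ps"
    unfolding ps_def by simp
  have set: "set ps = row_positions u k"
    unfolding ps_def row_positions_def using assms(1) by auto
  have carr: "gen_rows m C p \<in> carrier_vec m" if "p \<in> row_positions u k" for p
    using that gen_row_carrier[OF C] unfolding gen_rows_def row_positions_def by auto
  have L: "concat (map (\<lambda>j. map (gen_row m (C j)) [0..<k j]) (sorted_list_of_set u)) = map (gen_rows m C) ps"
    by (simp add: ps_def map_concat comp_def gen_rows_def)
  have "set (map (gen_rows m C) ps) \<subseteq> carrier_vec m"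
    using carr set by auto
  then have "rows (stacked_mat m C u k) = map (gen_rows m C) ps"
    unfolding stacked_mat_def L by (intro rows_mat_of_rows)
  moreover have "dim_col (stacked_mat m C u k) = m"
    by (simp add: stacked_mat_def)
  ultimately show ?thesis
    unfolding full_row_rank_def using distinct_lin_indpt_iff[OF dist set carr] set by simp
qed

section \<open>Digits of net points\<close>

primrec digit_prefix :: "nat \<Rightarrow> (nat \<Rightarrow> nat) \<Rightarrow> nat \<Rightarrow> nat" where
  "digit_prefix b d 0 = 0"
| "digit_prefix b d (Suc k) = b * digit_prefix b d k + d k"

lemma digit_prefix_eq_iff:
  assumes "\<And>i. d i < b" "\<And>i. d' i < b"
  shows "digit_prefix b d k = digit_prefix b d' k \<longleftrightarrow> (\<forall>i<k. d i = d' i)"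
proof (induction k)
  case 0
  then show ?case by simp
next
  case (Suc k)
  have "(b * x + d k = b * x' + d' k) = (x = x' \<and> d k = d' k)" for x x'
  proof (intro iffI)
    assume eq: "b * x + d k = b * x' + d' k"
    have "(b * x + d k) div b = x" "(b * x' + d' k) div b = x'"
      using assms[of k] by auto
    with eq have "x = x'" by metis
    with eq show "x = x' \<and> d k = d' k" by simp
  qed simp
  then show ?case
    using Suc.IH by (auto simp: less_Suc_eq)
qed

lemma digit_tail_bounds:
  fixes d :: "nat \<Rightarrow> nat"
  assumes b: "b \<ge> 2" and d: "\<And>i. d i < b"
  shows "0 \<le> (\<Sum>i<n. real (d i) / real b ^ (i + 1))"
    and "(\<Sum>i<n. real (d i) / real b ^ (i + 1)) < 1"
proof -
  have "(\<Sum>i<n. real (d i) / real b ^ (i + 1)) \<le> 1 - 1 / real b ^ n"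
  proof (induction n)
    case (Suc n)
    have "real (d n) \<le> real b - 1"
      using d[of n] by linarith
    then have "real (d n) / real b ^ (n + 1) \<le> (real b - 1) / real b ^ (n + 1)"
      by (intro divide_right_mono) auto
    also have "\<dots> = 1 / real b ^ n - 1 / real b ^ Suc n"
      using b by (simp add: field_simps)
    finally show ?case
      using Suc.IH by simp
  qed simp
  moreover have "1 / real b ^ n > 0"
    using b by simp
  ultimately show "(\<Sum>i<n. real (d i) / real b ^ (i + 1)) < 1"
    by linarith
  show "0 \<le> (\<Sum>i<n. real (d i) / real b ^ (i + 1))"
    by (intro sum_nonneg) auto
qed

text \<open>
  Multiplying by \<open>b\<^sup>k\<close> shifts the first \<open>k\<close> digits before the point. The remaining tail is
  less than \<open>1\<close> because the expansion is finite, so points with all digits \<open>b - 1\<close> cause no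
  exception.
\<close>

lemma floor_digit_prefix:
  fixes d :: "nat \<Rightarrow> nat"
  assumes b: "b \<ge> 2" and d: "\<And>i. d i < b" and zero: "\<And>i. i \<ge> n \<Longrightarrow> d i = 0"
  shows "\<lfloor>real b ^ k * (\<Sum>i<n. real (d i) / real b ^ (i + 1))\<rfloor> = int (digit_prefix b d k)"
proof -
  \<comment> \<open>The fractional part that is left after \<open>k\<close> digits. Its range \<open>i < n\<close> can be kept for all
    \<open>k\<close>, as the digits from \<open>n\<close> on are zero.\<close>
  define T where "T k = (\<Sum>i<n. real (d (k + i)) / real b ^ (i + 1))" for k
  have step: "real b * T k = real (d k) + T (Suc k)" for k
  proof (cases n)
    case 0
    then show ?thesis
      using zero by (simp add: T_def)
  next
    case (Suc n')
    have "real b * T k = (\<Sum>i<Suc n'. real (d (k + i)) / real b ^ i)"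
      using b unfolding T_def Suc sum_distrib_left by (intro sum.cong) auto
    also have "\<dots> = real (d k) + (\<Sum>i<n'. real (d (k + Suc i)) / real b ^ Suc i)"
      by (subst sum.lessThan_Suc_shift) simp
    also have "(\<Sum>i<n'. real (d (k + Suc i)) / real b ^ Suc i) = T (Suc k)"
      using zero[of "Suc (k + n')"] by (simp add: T_def Suc)
    finally show ?thesis .
  qed
  have "real b ^ k * T 0 = real (digit_prefix b d k) + T k"
  proof (induction k)
    case (Suc k)
    have "real b ^ Suc k * T 0 = real b * (real (digit_prefix b d k) + T k)"
      using Suc.IH by simp
    also have "\<dots> = real (digit_prefix b d (Suc k)) + T (Suc k)"
      using step[of k] by (simp add: distrib_left)
    finally show ?case .
  qed simp
  moreover have "0 \<le> T k" "T k < 1"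
    unfolding T_def using digit_tail_bounds[OF b, of "\<lambda>i. d (k + i)"] d by auto
  ultimately have "\<lfloor>real b ^ k * T 0\<rfloor> = int (digit_prefix b d k)"
    by (intro floor_unique) auto
  then show ?thesis
    by (simp add: T_def)
qed

lemma digits_determine:
  fixes h h' :: nat
  assumes "\<And>r. r < m \<Longrightarrow> h div b ^ r mod b = h' div b ^ r mod b"
  shows "h mod b ^ m = h' mod b ^ m"
  using assms
proof (induction m)
  case (Suc m)
  have "x mod b ^ Suc m = b ^ m * (x div b ^ m mod b) + x mod b ^ m" for x
    using mod_mult2_eq[of x "b ^ m" b] by (simp add: mult.commute)
  then show ?case
    using Suc by simp
qed simp

text \<open>
  A discrete intermediate value property: raise one entry at a time.
\<close>

lemma exists_between_with_sum:
  fixes lo hi :: "'i \<Rightarrow> nat"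
  assumes "finite u" and le: "\<And>j. j \<in> u \<Longrightarrow> lo j \<le> hi j"
    and t: "sum lo u \<le> t" "t \<le> sum hi u"
  shows "\<exists>f. (\<forall>j\<in>u. lo j \<le> f j \<and> f j \<le> hi j) \<and> sum f u = t"
  using t
proof (induction t rule: dec_induct)
  case base
  then show ?case
    using le by (intro exI[of _ lo]) auto
next
  case (step t)
  then obtain f where f: "\<forall>j\<in>u. lo j \<le> f j \<and> f j \<le> hi j" "sum f u = t"
    by auto
  obtain j where j: "j \<in> u" "f j < hi j"
  proof (rule ccontr)
    assume "\<not> thesis"
    then have "sum hi u \<le> sum f u"
      using that by (intro sum_mono) (meson not_le)
    then show False
      using step f by simp
  qed
  have "sum (f(j := Suc (f j))) u = Suc t"
    using j(1) \<open>finite u\<close> f(2) by (simp add: sum.remove[of u j])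
  then show ?case
    using f(1) j by (intro exI[of _ "f(j := Suc (f j))"]) auto
qed

text \<open>
  The number \<open>\<rho>\<close> with \<open>t\<^sub>u\<^sup>* = m + 1 - \<rho>\<close>.
\<close>

definition min_deficient_rows :: "nat \<Rightarrow> (nat \<Rightarrow> 'a::field mat) \<Rightarrow> nat set \<Rightarrow> nat" where
  "min_deficient_rows m C u =
     Inf {\<Sum>j\<in>u. k j | k. k \<in> u \<rightarrow>\<^sub>E {1..} \<and> \<not> full_row_rank (stacked_mat m C u k)}"

locale digital_net =
  fixes b m n s :: nat and \<phi> :: "nat \<Rightarrow> 'a::{field,finite}" and C :: "nat \<Rightarrow> 'a mat"
  assumes card_field: "CARD('a) = b"
    and \<phi>: "bij_betw \<phi> {0..<b} UNIV" "\<phi> 0 = 0"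
    and C: "\<And>j. j \<in> {1..s} \<Longrightarrow> C j \<in> carrier_mat n m"
begin

lemma base_ge_2: "b \<ge> 2"
  using card_field_ge_2[where 'a = 'a] card_field by simp

lemma gen_rows_carrier: "j \<in> {1..s} \<Longrightarrow> gen_rows m C (j, i) \<in> carrier_vec m"
  using gen_row_carrier[OF C] by (simp add: gen_rows_def)

lemma digit_vec_carrier [simp]: "digit_vec b \<phi> m h \<in> carrier_vec m"
  by (simp add: digit_vec_def)

text \<open>
  Digits determine the index, and both sides have \<open>b\<^sup>m\<close> elements.
\<close>

lemma bij_digit_vec: "bij_betw (digit_vec b \<phi> m) {..<b ^ m} (carrier_vec m)"
proof -
  have inj: "inj_on (digit_vec b \<phi> m) {..<b ^ m}"
  proof (rule inj_onI)
    fix h h' assume h: "h \<in> {..<b ^ m}" "h' \<in> {..<b ^ m}" and eq: "digit_vec b \<phi> m h = digit_vec b \<phi> m h'"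
    have "h div b ^ r mod b = h' div b ^ r mod b" if r: "r < m" for r
    proof -
      have "\<phi> (h div b ^ r mod b) = \<phi> (h' div b ^ r mod b)"
        using arg_cong[OF eq, of "\<lambda>v. v $ r"] r by (simp add: digit_vec_def)
      then show ?thesis
        using bij_betw_imp_inj_on[OF \<phi>(1)] base_ge_2 by (auto dest: inj_onD)
    qed
    then have "h mod b ^ m = h' mod b ^ m"
      by (rule digits_determine)
    then show "h = h'"
      using h by simp
  qed
  have "digit_vec b \<phi> m ` {..<b ^ m} = carrier_vec m"
    using card_image[OF inj] card_field
    by (intro card_subset_eq finite_carrier_vec) (auto simp: card_carrier_vec digit_vec_def)
  then show ?thesis
    using inj by (simp add: bij_betw_def)
qed

text \<open>
  The digits of a point are the images of the row products under the inverse of \<open>\<phi>\<close>. Beyond position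
  \<open>n\<close> the zero rows match the zero digits, because \<open>\<phi> 0 = 0\<close>.
\<close>

lemma floor_net_point_eq_iff:
  assumes j: "j \<in> {1..s}"
  shows "\<lfloor>real b ^ k * net_point b \<phi> m n C h j\<rfloor> = \<lfloor>real b ^ k * net_point b \<phi> m n C h' j\<rfloor>
    \<longleftrightarrow> (\<forall>i<k. gen_rows m C (j, i) \<bullet> (digit_vec b \<phi> m h - digit_vec b \<phi> m h') = 0)"
proof -
  define \<psi> where "\<psi> = inv_into {0..<b} \<phi>"
  have \<psi>: "\<psi> z < b" for z
    using inv_into_into[of z \<phi> "{0..<b}"] bij_betw_imp_surj_on[OF \<phi>(1)] by (auto simp: \<psi>_def)
  have \<psi>_0: "\<psi> 0 = 0"
    unfolding \<psi>_def using bij_betw_imp_inj_on[OF \<phi>(1)] \<phi>(2) base_ge_2 by (intro inv_into_f_eq) auto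
  have \<psi>_inj: "\<psi> z = \<psi> w \<longleftrightarrow> z = w" for z w
    unfolding \<psi>_def using bij_betw_imp_surj_on[OF \<phi>(1)] by (metis UNIV_I f_inv_into_f)
  define d where "d h i = \<psi> (gen_rows m C (j, i) \<bullet> digit_vec b \<phi> m h)" for h i
  have point: "net_point b \<phi> m n C h j = (\<Sum>i<n. real (d h i) / real b ^ (i + 1))" for h
  proof -
    have "(C j *\<^sub>v digit_vec b \<phi> m h) $ i = gen_rows m C (j, i) \<bullet> digit_vec b \<phi> m h" if "i < n" for i
      using C[OF j] that by (simp add: gen_rows_def gen_row_def)
    then have "(\<Sum>i<n. real (d h i) / real b ^ (i + 1))
        = (\<Sum>i<n. real (\<psi> ((C j *\<^sub>v digit_vec b \<phi> m h) $ i)) / real b ^ Suc i)"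
      by (simp add: d_def)
    also have "\<dots> = (\<Sum>i = 1..n. real (\<psi> ((C j *\<^sub>v digit_vec b \<phi> m h) $ (i - 1))) / real b ^ i)"
      by (rule sum.reindex_bij_witness[of _ "\<lambda>i. i - 1" Suc]) auto
    finally show ?thesis
      by (simp add: net_point_def \<psi>_def)
  qed
  have zero: "d h i = 0" if "i \<ge> n" for h i
    using C[OF j] that by (simp add: d_def gen_rows_def gen_row_def \<psi>_0)
  have "d h i = d h' i \<longleftrightarrow> gen_rows m C (j, i) \<bullet> (digit_vec b \<phi> m h - digit_vec b \<phi> m h') = 0" for i
    using scalar_prod_minus_distrib[OF gen_rows_carrier[OF j], of "digit_vec b \<phi> m h" "digit_vec b \<phi> m h'" i]
    by (simp add: d_def \<psi>_inj)
  moreover have "\<lfloor>real b ^ k * net_point b \<phi> m n C h j\<rfloor> = int (digit_prefix b (d h) k)" for h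
    unfolding point using base_ge_2 zero \<psi> by (intro floor_digit_prefix) (auto simp: d_def)
  ultimately show ?thesis
    using digit_prefix_eq_iff[of "d h" b "d h'" k] \<psi> by (simp add: d_def)
qed

lemma of_nat_base_minus_1: "real (b - 1) = real b - 1"
  using base_ge_2 by (simp add: of_nat_diff)

lemma finite_net_index: "u \<subseteq> {1..s} \<Longrightarrow> finite u"
  by (rule finite_subset) auto

lemma finite_row_positions: "u \<subseteq> {1..s} \<Longrightarrow> finite (row_positions u k)"
  unfolding row_positions_def using finite_net_index by auto

lemma card_row_positions: "u \<subseteq> {1..s} \<Longrightarrow> card (row_positions u k) = (\<Sum>j\<in>u. k j)"
  unfolding row_positions_def using finite_net_index by (simp add: card_SigmaI)

lemma row_positions_carrier:
  "u \<subseteq> {1..s} \<Longrightarrow> p \<in> row_positions u k \<Longrightarrow> gen_rows m C p \<in> carrier_vec m"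
  unfolding row_positions_def using gen_rows_carrier by auto

section \<open>Gain coefficients count relations\<close>

abbreviation net_kernel :: "nat set \<Rightarrow> (nat \<Rightarrow> nat) \<Rightarrow> 'a vec set" where
  "net_kernel u k \<equiv> family_kernel m (gen_rows m C) (row_positions u k)"

text \<open>
  The relations, without zero coefficients, among the rows that follow the first \<open>k\<^bsub>j\<^esub>\<close> rows of
  each \<open>C\<^bsub>j\<^esub>\<close>, read as functionals on the kernel of those first rows.
\<close>

abbreviation next_relations :: "nat set \<Rightarrow> (nat \<Rightarrow> nat) \<Rightarrow> (nat \<Rightarrow> 'a) set" where
  "next_relations u k \<equiv> {a \<in> u \<rightarrow>\<^sub>E UNIV - {0}.
     \<forall>y\<in>net_kernel u k. (\<Sum>j\<in>u. a j * (gen_rows m C (j, k j) \<bullet> y)) = 0}"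

lemma net_kernel_iff:
  "y \<in> net_kernel u k \<longleftrightarrow> y \<in> carrier_vec m \<and> (\<forall>j\<in>u. \<forall>i<k j. gen_rows m C (j, i) \<bullet> y = 0)"
  unfolding family_kernel_def row_positions_def by auto

lemma closed_net_kernel: "u \<subseteq> {1..s} \<Longrightarrow> closed_under_combos m (net_kernel u k)"
  by (rule closed_under_combos_kernel) (rule row_positions_carrier)

lemma functional_on_net_kernel:
  assumes "j \<in> {1..s}"
  shows "functional_on (net_kernel u k) (\<lambda>y. gen_rows m C (j, i) \<bullet> y)"
  by (rule functional_on_subset[OF functional_on_scalar_prod[OF gen_rows_carrier[OF assms]]])
    (auto simp: family_kernel_def)

lemma card_net_kernel_ge:
  assumes "u \<subseteq> {1..s}"
  shows "b ^ m \<le> b ^ sum k u * card (net_kernel u k)"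
  using card_kernel_ge[of "row_positions u k" "gen_rows m C" m]
    finite_row_positions[OF assms] row_positions_carrier[OF assms]
  unfolding card_field card_row_positions[OF assms] by blast

lemma card_net_kernel_indep:
  assumes "u \<subseteq> {1..s}" and "family_indep m (gen_rows m C) (row_positions u k)"
  shows "b ^ sum k u * card (net_kernel u k) = b ^ m"
  using card_kernel_indep[of "row_positions u k" "gen_rows m C" m]
    finite_row_positions[OF assms(1)] row_positions_carrier[OF assms(1)] assms(2)
  unfolding card_field card_row_positions[OF assms(1)] by blast

text \<open>
  A pair of points enters only through the difference of its digit vectors, and every vector is such a difference exactly
  \<open>b\<^sup>m\<close> times. Outside the kernel some factor has both indicators equal to zero; inside, each factor is
  \<open>K\<close> of the next row product divided by \<open>b - 1\<close>.
\<close>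

lemma gain_coeff_eq:
  assumes u: "u \<subseteq> {1..s}"
  shows "gain_coeff b (b ^ m) (net_point b \<phi> m n C) u k
    = real (card (net_kernel u k)) * real (card (next_relations u k)) / (real b - 1) ^ card u"
proof -
  let ?r = "gen_rows m C" and ?Y = "digit_vec b \<phi> m" and ?P = "net_point b \<phi> m n C"
  define G where "G y = (\<Prod>j\<in>u. (real b * of_bool (\<forall>i<k j + 1. ?r (j, i) \<bullet> y = 0)
      - of_bool (\<forall>i<k j. ?r (j, i) \<bullet> y = 0)) / (real b - 1))" for y
  have fin: "finite u"
    using u by (rule finite_net_index)
  have inner: "(\<Sum>h'<b ^ m. G (?Y h - ?Y h')) = (\<Sum>y\<in>carrier_vec m. G y)" for h
  proof -
    have "bij_betw (\<lambda>y. ?Y h - y) (carrier_vec m) (carrier_vec m)"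
      by (rule bij_betw_byWitness[where f' = "\<lambda>y. ?Y h - y"])
        (auto intro!: eq_vecI simp: digit_vec_def)
    then have "bij_betw (\<lambda>h'. ?Y h - ?Y h') {..<b ^ m} (carrier_vec m)"
      using bij_betw_trans[OF bij_digit_vec] by (simp add: comp_def)
    then show ?thesis
      by (rule sum.reindex_bij_betw)
  qed
  have "gain_coeff b (b ^ m) ?P u k = (1 / real (b ^ m)) * (\<Sum>h<b ^ m. \<Sum>h'<b ^ m. G (?Y h - ?Y h'))"
  proof -
    have "(\<lfloor>real b ^ l * ?P h j\<rfloor> = \<lfloor>real b ^ l * ?P h' j\<rfloor>)
        = (\<forall>i<l. ?r (j, i) \<bullet> (?Y h - ?Y h') = 0)" if "j \<in> u" for l h h' j
      using that u by (intro floor_net_point_eq_iff) auto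
    then show ?thesis
      unfolding gain_coeff_def G_def
      by (intro arg_cong2[where f = "(*)"] sum.cong prod.cong refl) (simp only:)
  qed
  also have "\<dots> = (1 / real (b ^ m)) * (\<Sum>h<b ^ m. \<Sum>y\<in>carrier_vec m. G y)"
    unfolding inner ..
  also have "\<dots> = (\<Sum>y\<in>carrier_vec m. G y)"
    using base_ge_2 by simp
  also have "\<dots> = (\<Sum>y\<in>net_kernel u k. G y)"
  proof (rule sum.mono_neutral_right)
    show "\<forall>y\<in>carrier_vec m - net_kernel u k. G y = 0"
    proof
      fix y assume y: "y \<in> carrier_vec m - net_kernel u k"
      then have "y \<in> carrier_vec m" "y \<notin> net_kernel u k"
        by auto
      then obtain j i where j: "j \<in> u" and i: "i < k j" "?r (j, i) \<bullet> y \<noteq> 0"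
        unfolding net_kernel_iff by blast
      have "\<not> (\<forall>i<k j + 1. ?r (j, i) \<bullet> y = 0)" "\<not> (\<forall>i<k j. ?r (j, i) \<bullet> y = 0)"
        using i by (auto intro!: exI[of _ i])
      then show "G y = 0"
        unfolding G_def using fin j by (intro prod_zero) auto
    qed
  qed (auto simp: family_kernel_def)
  also have "\<dots> = (\<Sum>y\<in>net_kernel u k. (\<Prod>j\<in>u. zero_char (?r (j, k j) \<bullet> y)) / (real b - 1) ^ card u)"
  proof (rule sum.cong[OF refl])
    fix y assume y: "y \<in> net_kernel u k"
    have "(\<forall>i<k j + 1. ?r (j, i) \<bullet> y = 0) = (?r (j, k j) \<bullet> y = 0)" "\<forall>i<k j. ?r (j, i) \<bullet> y = 0"
      if "j \<in> u" for j
      using y that unfolding net_kernel_iff by (auto simp: less_Suc_eq)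
    then have "G y = (\<Prod>j\<in>u. zero_char (?r (j, k j) \<bullet> y) / (real b - 1))"
      unfolding G_def zero_char_def card_field by (intro prod.cong refl) simp
    then show "G y = (\<Prod>j\<in>u. zero_char (?r (j, k j) \<bullet> y)) / (real b - 1) ^ card u"
      by (simp add: prod_dividef)
  qed
  also have "\<dots> = (\<Sum>y\<in>net_kernel u k. \<Prod>j\<in>u. zero_char (?r (j, k j) \<bullet> y)) / (real b - 1) ^ card u"
    by (rule sum_divide_distrib[symmetric])
  also have "\<dots> = real (card (net_kernel u k)) * real (card (next_relations u k)) / (real b - 1) ^ card u"
  proof -
    have "functional_on (net_kernel u k) (\<lambda>y. ?r (j, k j) \<bullet> y)" if "j \<in> u" for j
      using functional_on_net_kernel u that by blast
    then have "(\<Sum>y\<in>net_kernel u k. \<Prod>j\<in>u. zero_char (?r (j, k j) \<bullet> y))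
        = real (card (net_kernel u k)) * real (card (next_relations u k))"
      by (rule sum_prod_zero_char[OF closed_net_kernel[OF u] fin])
    then show ?thesis
      by (rule arg_cong)
  qed
  finally show ?thesis .
qed

section \<open>Bounds for a single gain coefficient\<close>

text \<open>
  Let \<open>V\<close> be the kernel of the first \<open>k\<^bsub>j\<^esub>\<close> rows, and \<open>W\<close> the kernel
  with one more row from each matrix. If there is a relation, then the rank of the new rows on \<open>V\<close> is some
  \<open>r < \<bar>u\<bar>\<close>, and \<open>\<bar>V\<bar> = b\<^sup>r \<bar>W\<bar>\<close>. This excludes that the
  rows defining \<open>W\<close> are independent, so there are at least \<open>\<rho>\<close> of them, and
  \<open>\<rho> - 1\<close> of them form an independent family with at least one row from each matrix. This bounds
  \<open>\<bar>W\<bar>\<close>.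
\<close>

lemma gain_coeff_le:
  assumes u: "u \<subseteq> {1..s}" "u \<noteq> {}" and \<rho>: "card u < \<rho>"
    and ind: "\<And>k'. (\<And>j. j \<in> u \<Longrightarrow> 1 \<le> k' j) \<Longrightarrow> sum k' u < \<rho>
      \<Longrightarrow> family_indep m (gen_rows m C) (row_positions u k')"
  shows "gain_coeff b (b ^ m) (net_point b \<phi> m n C) u k
    \<le> real b ^ (m + card u) / (real b ^ \<rho> * (real b - 1) ^ (card u - 1))"
proof (cases "next_relations u k = {}")
  case True
  then have "gain_coeff b (b ^ m) (net_point b \<phi> m n C) u k = 0"
    unfolding gain_coeff_eq[OF u(1)] True by simp
  then show ?thesis
    using base_ge_2 by simp
next
  case False
  let ?V = "net_kernel u k" and ?A = "next_relations u k"
  define k1 where "k1 j = k j + 1" for j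
  let ?W = "net_kernel u k1"
  have fin: "finite u"
    using u(1) by (rule finite_net_index)
  have W: "{y \<in> ?V. \<forall>j\<in>u. gen_rows m C (j, k j) \<bullet> y = 0} = ?W"
    unfolding k1_def by (auto simp: net_kernel_iff less_Suc_eq)
  obtain r where r: "r < card u" and V: "card ?V = b ^ r * card ?W"
    and A: "card ?A \<le> (b - 1) ^ (card u - r)"
    using card_nonzero_relations_bounds[OF closed_net_kernel[OF u(1)] fin functional_on_net_kernel False u(2)]
      u(1) unfolding card_field W by blast
  have card_u: "card u \<ge> 1"
    using r by simp
  have sum_k1: "sum k1 u = sum k u + card u"
    unfolding k1_def by (simp add: sum.distrib flip: One_nat_def del: add_Suc_right)
  have W_pos: "card ?W > 0"
    using card_net_kernel_ge[OF u(1), of k1] base_ge_2 by (intro gr0I) auto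
  \<comment> \<open>Otherwise \<open>\<bar>V\<bar> \<ge> b\<^bsup>\<bar>u\<bar>\<^esup> \<bar>W\<bar>\<close>, against \<open>\<bar>V\<bar> = b\<^sup>r \<bar>W\<bar>\<close>.\<close>
  have "\<rho> \<le> sum k1 u"
  proof (rule ccontr)
    assume "\<not> \<rho> \<le> sum k1 u"
    then have "family_indep m (gen_rows m C) (row_positions u k1)"
      by (intro ind) (auto simp: k1_def)
    then have "b ^ (sum k u + card u) * card ?W = b ^ m"
      using card_net_kernel_indep[OF u(1)] sum_k1 by metis
    also have "\<dots> \<le> b ^ sum k u * (b ^ r * card ?W)"
      using card_net_kernel_ge[OF u(1), of k] unfolding V .
    also have "\<dots> = b ^ (sum k u + r) * card ?W"
      by (simp add: power_add)
    also have "\<dots> < b ^ (sum k u + card u) * card ?W"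
      using W_pos r base_ge_2 by simp
    finally show False by simp
  qed
  then obtain k' where k': "\<forall>j\<in>u. 1 \<le> k' j \<and> k' j \<le> k1 j" "sum k' u = \<rho> - 1"
    using exists_between_with_sum[OF fin, of "\<lambda>_. 1" k1 "\<rho> - 1"] \<rho> by (fastforce simp: k1_def)
  have "b ^ (\<rho> - 1) * card ?W \<le> b ^ (\<rho> - 1) * card (net_kernel u k')"
    using k'(1) by (intro mult_left_mono card_mono closed_under_combos_finite[OF closed_net_kernel[OF u(1)]])
      (force simp: net_kernel_iff)+
  also have "\<dots> = b ^ m"
    using card_net_kernel_indep[OF u(1) ind[of k']] k' \<rho> by simp
  finally have W_le: "b ^ (\<rho> - 1) * card ?W \<le> b ^ m" .
  \<comment> \<open>Replace \<open>c = \<bar>u\<bar> - 1 - r\<close> of the factors \<open>b - 1\<close> by \<open>b\<close>: this is the bound at \<open>r = \<bar>u\<bar> - 1\<close>.\<close>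
  obtain c where c: "card u = r + c + 1"
    using r less_iff_Suc_add by auto
  have "b ^ \<rho> * (card ?V * card ?A) = b ^ (r + 1) * (b ^ (\<rho> - 1) * card ?W) * card ?A"
    using \<rho> unfolding V by (cases \<rho>) (simp_all add: power_add)
  also have "\<dots> \<le> b ^ (r + 1) * b ^ m * (b ^ c * (b - 1))"
  proof (intro mult_mono le_refl W_le)
    have "(b - 1) ^ c * (b - 1) \<le> b ^ c * (b - 1)"
      by (intro mult_right_mono power_mono) auto
    moreover have "(b - 1) ^ (card u - r) = (b - 1) ^ c * (b - 1)"
      by (simp add: c)
    ultimately show "card ?A \<le> b ^ c * (b - 1)"
      using A by linarith
  qed auto
  also have "\<dots> = b ^ (m + card u) * (b - 1)"
    by (simp add: c power_add)
  finally have "real (b ^ \<rho> * (card ?V * card ?A)) \<le> real (b ^ (m + card u) * (b - 1))"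
    by (rule of_nat_mono)
  then have real_le: "real b ^ \<rho> * (real (card ?V) * real (card ?A)) \<le> real b ^ (m + card u) * (real b - 1)"
    by (simp only: of_nat_mult of_nat_power of_nat_base_minus_1)
  have pow: "(real b - 1) ^ card u = (real b - 1) * (real b - 1) ^ (card u - 1)"
    using card_u by (simp add: power_eq_if)
  have "gain_coeff b (b ^ m) (net_point b \<phi> m n C) u k
      = real b ^ \<rho> * (real (card ?V) * real (card ?A)) / (real b ^ \<rho> * (real b - 1) ^ card u)"
    unfolding gain_coeff_eq[OF u(1)] using base_ge_2 by simp
  also have "\<dots> \<le> real b ^ (m + card u) * (real b - 1) / (real b ^ \<rho> * (real b - 1) ^ card u)"
    using real_le base_ge_2 by (intro divide_right_mono) auto
  also have "\<dots> = real b ^ (m + card u) / (real b ^ \<rho> * (real b - 1) ^ (card u - 1))"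
    unfolding pow using base_ge_2 by simp
  finally show ?thesis .
qed

text \<open>
  On the kernel of the first \<open>k\<^bsub>j\<^esub> - 1\<close> rows, the given relation reduces to one among the last
  rows, all of whose coefficients are nonzero. Its nonzero multiples give \<open>b - 1\<close> relations, and a kernel of
  \<open>l\<close> rows has at least \<open>b\<^bsup>m - l\<^esup>\<close> elements, whatever their rank.
\<close>

lemma gain_coeff_ge:
  assumes w: "w \<subseteq> {1..s}" "w \<noteq> {}" and k: "\<And>j. j \<in> w \<Longrightarrow> 1 \<le> k j"
    and rel: "family_relation m (gen_rows m C) (row_positions w k) a"
    and nz: "\<And>j. j \<in> w \<Longrightarrow> a (j, k j - 1) \<noteq> 0"
  shows "real b ^ (m + card w) / (real b ^ sum k w * (real b - 1) ^ (card w - 1))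
    \<le> gain_coeff b (b ^ m) (net_point b \<phi> m n C) w (\<lambda>j. k j - 1)"
proof -
  let ?k = "\<lambda>j. k j - 1"
  let ?V = "net_kernel w ?k" and ?A = "next_relations w ?k"
  have fin: "finite w"
    using w(1) by (rule finite_net_index)
  have A: "b - 1 \<le> card ?A"
    unfolding card_field[symmetric]
  proof (rule card_nonzero_relations_ge[OF fin w(2), of "\<lambda>j. a (j, k j - 1)"])
    fix y assume y: "y \<in> ?V"
    then have y': "y \<in> carrier_vec m" "\<And>j i. j \<in> w \<Longrightarrow> i < k j - 1 \<Longrightarrow> gen_rows m C (j, i) \<bullet> y = 0"
      unfolding net_kernel_iff by auto
    have "(\<Sum>j\<in>w. a (j, k j - 1) * (gen_rows m C (j, k j - 1) \<bullet> y))
        = (\<Sum>j\<in>w. \<Sum>i<k j. a (j, i) * (gen_rows m C (j, i) \<bullet> y))"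
    proof (rule sum.cong[OF refl])
      fix j assume j: "j \<in> w"
      then have "{..<k j} = insert (k j - 1) {..<k j - 1}"
        using k[OF j] by auto
      moreover have "(\<Sum>i<k j - 1. a (j, i) * (gen_rows m C (j, i) \<bullet> y)) = 0"
        using y'(2)[OF j] by (intro sum.neutral) auto
      ultimately show "a (j, k j - 1) * (gen_rows m C (j, k j - 1) \<bullet> y)
          = (\<Sum>i<k j. a (j, i) * (gen_rows m C (j, i) \<bullet> y))"
        by simp
    qed
    also have "\<dots> = (\<Sum>p\<in>row_positions w k. a p * (gen_rows m C p \<bullet> y))"
      unfolding row_positions_def using fin by (simp add: sum.Sigma)
    also have "\<dots> = 0"
      using rel y'(1) family_relation_iff[of "row_positions w k" "gen_rows m C" m a] row_positions_carrier[OF w(1)]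
      by blast
    finally show "(\<Sum>j\<in>w. a (j, k j - 1) * (gen_rows m C (j, k j - 1) \<bullet> y)) = 0" .
  qed (rule nz)
  have "sum k w = (\<Sum>j\<in>w. ?k j + 1)"
    using k by (intro sum.cong refl) (metis le_add_diff_inverse2)
  then have sum_k: "sum k w = sum ?k w + card w"
    unfolding sum.distrib by simp
  have "b ^ m \<le> b ^ sum ?k w * card ?V"
    using card_net_kernel_ge[OF w(1)] .
  then have "b ^ m * (b - 1) \<le> b ^ sum ?k w * card ?V * card ?A"
    using A by (rule mult_mono) auto
  then have "real (b ^ m * (b - 1)) \<le> real (b ^ sum ?k w * card ?V * card ?A)"
    by (rule of_nat_mono)
  then have V: "real b ^ m * (real b - 1) \<le> real b ^ sum ?k w * (real (card ?V) * real (card ?A))"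
    by (simp only: of_nat_mult of_nat_power of_nat_base_minus_1 mult.assoc)
  have "card w \<ge> 1"
    using fin w(2) by (simp add: Suc_leI card_gt_0_iff)
  then have pow: "(real b - 1) ^ card w = (real b - 1) * (real b - 1) ^ (card w - 1)"
    by (simp add: power_eq_if)
  have "real b ^ (m + card w) / (real b ^ sum k w * (real b - 1) ^ (card w - 1))
      = real b ^ m * (real b - 1) / (real b ^ sum ?k w * (real b - 1) ^ card w)"
    unfolding pow sum_k power_add using base_ge_2 by simp
  also have "\<dots> \<le> real b ^ sum ?k w * (real (card ?V) * real (card ?A)) / (real b ^ sum ?k w * (real b - 1) ^ card w)"
    using V base_ge_2 by (intro divide_right_mono) auto
  also have "\<dots> = gain_coeff b (b ^ m) (net_point b \<phi> m n C) w ?k"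
    unfolding gain_coeff_eq[OF w(1)] using base_ge_2 by simp
  finally show ?thesis .
qed

section \<open>The deficiency threshold and the maximal gain coefficients\<close>

abbreviation \<rho> :: "nat set \<Rightarrow> nat" where
  "\<rho> \<equiv> min_deficient_rows m C"

abbreviation stacked_indep :: "nat set \<Rightarrow> (nat \<Rightarrow> nat) \<Rightarrow> bool" where
  "stacked_indep u k \<equiv> family_indep m (gen_rows m C) (row_positions u k)"

lemma full_row_rank_stacked_iff:
  assumes "u \<subseteq> {1..s}"
  shows "full_row_rank (stacked_mat m C u k) \<longleftrightarrow> stacked_indep u k"
  using assms by (intro full_row_rank_iff[where n = n] finite_net_index C) auto

lemma gain_bound_eq:
  "gain_bound b m C u = real b ^ (m + card u) / (real b ^ \<rho> u * (real b - 1) ^ (card u - 1))"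
proof -
  have "real b powi (t_star m C u + int (card u) - 1) = real b powi (int (m + card u) - int (\<rho> u))"
    by (simp add: t_star_def min_deficient_rows_def algebra_simps)
  also have "\<dots> = real b ^ (m + card u) / real b ^ \<rho> u"
    using base_ge_2 by (subst power_int_diff) (simp_all only: power_int_of_nat, simp)
  finally show ?thesis
    by (simp add: gain_bound_def)
qed

lemma min_deficient_rows_attained:
  assumes u: "u \<subseteq> {1..s}" "u \<noteq> {}"
  obtains k where "\<And>j. j \<in> u \<Longrightarrow> 1 \<le> k j" "sum k u = \<rho> u" "\<not> stacked_indep u k"
proof -
  have "{\<Sum>j\<in>u. k j | k. k \<in> u \<rightarrow>\<^sub>E {1..} \<and> \<not> full_row_rank (stacked_mat m C u k)} \<noteq> {}"
    using ex_not_full_row_rank[OF finite_net_index[OF u(1)] u(2), of C n m] C u(1) by blast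
  then have "\<rho> u \<in> {\<Sum>j\<in>u. k j | k. k \<in> u \<rightarrow>\<^sub>E {1..} \<and> \<not> full_row_rank (stacked_mat m C u k)}"
    unfolding min_deficient_rows_def by (rule Inf_nat_def1)
  then obtain k where k: "k \<in> u \<rightarrow>\<^sub>E {1..}" "\<rho> u = sum k u" "\<not> full_row_rank (stacked_mat m C u k)"
    by blast
  show ?thesis
  proof (rule that)
    show "1 \<le> k j" if "j \<in> u" for j
      using PiE_mem[OF k(1) that] by simp
  qed (use k full_row_rank_stacked_iff[OF u(1)] in auto)
qed

lemma stacked_indep_below:
  assumes u: "u \<subseteq> {1..s}" and k: "\<And>j. j \<in> u \<Longrightarrow> 1 \<le> k j" and less: "sum k u < \<rho> u"
  shows "stacked_indep u k"
proof (rule ccontr)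
  assume "\<not> stacked_indep u k"
  moreover have "row_positions u (restrict k u) = row_positions u k"
    by (auto simp: row_positions_def)
  ultimately have "\<not> full_row_rank (stacked_mat m C u (restrict k u))"
    using full_row_rank_stacked_iff[OF u] by simp
  moreover have "restrict k u \<in> u \<rightarrow>\<^sub>E {1..}" "sum k u = (\<Sum>j\<in>u. restrict k u j)"
    using k by auto
  ultimately have "sum k u \<in> {\<Sum>j\<in>u. k j | k. k \<in> u \<rightarrow>\<^sub>E {1..} \<and> \<not> full_row_rank (stacked_mat m C u k)}"
    by blast
  then have "\<rho> u \<le> sum k u"
    unfolding min_deficient_rows_def by (intro cInf_lower) auto
  then show False
    using less by simp
qed

text \<open>
  At least \<open>\<bar>u\<bar>\<close> rows are always taken, and exactly \<open>\<bar>u\<bar>\<close> only for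
  \<open>k = (1, \<dots>, 1)\<close>, where the rank is full by assumption.
\<close>

lemma card_less_min_deficient_rows:
  assumes u: "u \<subseteq> {1..s}" "u \<noteq> {}" and ones: "stacked_indep u (\<lambda>_. 1)"
  shows "card u < \<rho> u"
proof (rule ccontr)
  obtain k where k: "\<And>j. j \<in> u \<Longrightarrow> 1 \<le> k j" "sum k u = \<rho> u" "\<not> stacked_indep u k"
    using min_deficient_rows_attained[OF u] by blast
  have fin: "finite u"
    using u(1) by (rule finite_net_index)
  assume "\<not> card u < \<rho> u"
  then have le: "sum k u \<le> (\<Sum>j\<in>u. 1)"
    using k(2) by simp
  have "k j = 1" if "j \<in> u" for j
  proof (rule ccontr)
    assume "k j \<noteq> 1"
    with k(1)[OF that] have "1 < k j" by linarith
    then have "(\<Sum>j\<in>u. 1) < sum k u"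
      using fin k(1) that by (intro sum_strict_mono_ex1) blast+
    then show False
      using le by linarith
  qed
  then have "row_positions u k = row_positions u (\<lambda>_. 1)"
    by (auto simp: row_positions_def)
  then show False
    using k(3) ones by simp
qed

lemma stacked_indep_ones_subset:
  assumes "u \<subseteq> {1..s}" "v \<subseteq> u" "stacked_indep u (\<lambda>_. 1)"
  shows "stacked_indep v (\<lambda>_. 1)"
  by (rule family_indep_subset[OF assms(3) _ finite_row_positions[OF assms(1)]])
    (use assms(2) in \<open>auto simp: row_positions_def\<close>)

lemma gain_coeff_le_gain_bound:
  assumes u: "u \<subseteq> {1..s}" "u \<noteq> {}" and ones: "stacked_indep u (\<lambda>_. 1)"
  shows "gain_coeff b (b ^ m) (net_point b \<phi> m n C) u k \<le> gain_bound b m C u"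
  unfolding gain_bound_eq using gain_coeff_le[OF u card_less_min_deficient_rows[OF u ones]]
    stacked_indep_below[OF u(1)] by blast

text \<open>
  Passing from \<open>v\<close> to \<open>w\<close> removes \<open>\<bar>v\<bar> - \<bar>w\<bar>\<close> matrices, each
  contributing a single row, so the difference between cardinality and number of rows is the same for both sets. Only the
  power of \<open>b - 1\<close> in the denominator changes, and it gets smaller.
\<close>

lemma gain_bound_le_some_gain_coeff:
  assumes v: "v \<subseteq> {1..s}" "v \<noteq> {}"
  obtains w k where "w \<subseteq> v" "w \<noteq> {}"
    "gain_bound b m C v \<le> gain_coeff b (b ^ m) (net_point b \<phi> m n C) w k"
proof -
  obtain k where k: "\<And>j. j \<in> v \<Longrightarrow> 1 \<le> k j" "sum k v = \<rho> v" "\<not> stacked_indep v k"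
    using min_deficient_rows_attained[OF v] by blast
  have fin: "finite v"
    using v(1) by (rule finite_net_index)
  note fin_pos = finite_row_positions[OF v(1), of k]
  obtain a p where rel: "family_relation m (gen_rows m C) (row_positions v k) a"
    and p: "p \<in> row_positions v k" "a p \<noteq> 0"
    using k(3) unfolding family_indep_def by blast
  define w where "w = {j \<in> v. a (j, k j - 1) \<noteq> 0}"
  have w: "w \<subseteq> v"
    by (auto simp: w_def)
  have one: "k j = 1" if j: "j \<in> v - w" for j
  proof (rule ccontr)
    assume "k j \<noteq> 1"
    then have kj: "k j \<ge> 2"
      using k(1)[of j] j by simp
    have zero: "a (j, k j - 1) = 0"
      using j by (simp add: w_def)
    \<comment> \<open>Dropping the last row of \<open>C j\<close> loses nothing, since its coefficient is zero. The remaining rows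
      number \<open>\<rho> - 1\<close> and are independent, a contradiction.\<close>
    define k' where "k' = k(j := k j - 1)"
    have diff: "row_positions v k - row_positions v k' \<subseteq> {(j, k j - 1)}"
      "row_positions v k' \<subseteq> row_positions v k"
      by (auto simp: row_positions_def k'_def split: if_splits)
    have "sum k' v < \<rho> v"
      unfolding k(2)[symmetric] using fin j kj by (intro sum_strict_mono_ex1) (auto simp: k'_def)
    then have "stacked_indep v k'"
      using k(1) kj by (intro stacked_indep_below[OF v(1)]) (auto simp: k'_def)
    moreover have "family_relation m (gen_rows m C) (row_positions v k') a"
      using family_relation_restrict[OF rel fin_pos diff(2)] diff(1) zero by blast
    ultimately have "\<forall>q\<in>row_positions v k'. a q = 0"
      unfolding family_indep_def by blast
    then show False
      using p diff(1) zero by blast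
  qed
  have off_w: "a q = 0" if q_pos: "q \<in> row_positions v k - row_positions w k" for q
  proof -
    obtain j i where q: "q = (j, i)" "j \<in> v - w" "i < k j"
      using q_pos unfolding row_positions_def by blast
    then show ?thesis
      using one[OF q(2)] by (auto simp: w_def)
  qed
  have "w \<noteq> {}"
    using off_w[of p] p by (auto simp: row_positions_def)
  have rel_w: "family_relation m (gen_rows m C) (row_positions w k) a"
    using w by (intro family_relation_restrict[OF rel fin_pos _ off_w]) (auto simp: row_positions_def)
  have "card v = card w + card (v - w)"
    using fin w by (metis card_Diff_subset card_mono finite_subset le_add_diff_inverse)
  moreover have "\<rho> v = sum k w + card (v - w)"
    using sum.subset_diff[OF w fin, of k] one k(2) by simp
  moreover have "(real b - 1) ^ (card w - 1) \<le> (real b - 1) ^ (card v - 1)"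
    using base_ge_2 card_mono[OF fin w] by (intro power_increasing) auto
  ultimately have "gain_bound b m C v \<le> real b ^ (m + card w) / (real b ^ sum k w * (real b - 1) ^ (card w - 1))"
    unfolding gain_bound_eq using base_ge_2 by (simp add: power_add frac_le)
  also have "\<dots> \<le> gain_coeff b (b ^ m) (net_point b \<phi> m n C) w (\<lambda>j. k j - 1)"
    using v(1) w k(1) \<open>w \<noteq> {}\<close> by (intro gain_coeff_ge[OF _ _ _ rel_w]) (auto simp: w_def)
  finally show ?thesis
    using that w \<open>w \<noteq> {}\<close> by blast
qed

lemma gain_coeff_le_max_gain:
  assumes "u \<subseteq> {1..s}"
  shows "gain_coeff b N x u k \<le> max_gain b N x u"
proof -
  have "gain_coeff b N x u k = gain_coeff b N x u (restrict k u)"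
    unfolding gain_coeff_def by (simp cong: prod.cong)
  then show ?thesis
    unfolding max_gain_def using finite_gain_coeff_values[OF finite_net_index[OF assms]]
    by (intro Max_ge) auto
qed

lemma max_gain_le_gain_bound:
  assumes u: "u \<subseteq> {1..s}" "u \<noteq> {}" and ones: "stacked_indep u (\<lambda>_. 1)"
  shows "max_gain b (b ^ m) (net_point b \<phi> m n C) u \<le> gain_bound b m C u"
proof -
  have "(u \<rightarrow>\<^sub>E (UNIV :: nat set)) \<noteq> {}"
    by (simp add: PiE_eq_empty_iff)
  then show ?thesis
    unfolding max_gain_def
    using finite_gain_coeff_values[OF finite_net_index[OF u(1)]] gain_coeff_le_gain_bound[OF u ones]
    by (intro Max.boundedI) auto
qed

text \<open>
  Each gain coefficient is at most the bound for its own index set, and each bound is at most a gain coefficient for a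
  possibly smaller index set. The maxima over all nonempty subsets therefore agree, although the individual terms need
  not.
\<close>

lemma max_gain_star_eq:
  assumes u: "u \<subseteq> {1..s}" "u \<noteq> {}" and ones: "stacked_indep u (\<lambda>_. 1)"
  shows "max_gain_star b (b ^ m) (net_point b \<phi> m n C) u = Max (gain_bound b m C ` {v. v \<noteq> {} \<and> v \<subseteq> u})"
    (is "_ = Max (?B ` ?S)")
proof -
  let ?M = "max_gain b (b ^ m) (net_point b \<phi> m n C)"
  have fin: "finite ?S"
    using finite_net_index[OF u(1)] by simp
  have ne: "?S \<noteq> {}"
    using u(2) by blast
  have "?M v \<le> Max (?B ` ?S)" if "v \<in> ?S" for v
  proof -
    have "?M v \<le> ?B v"
      using that u(1) stacked_indep_ones_subset[OF u(1) _ ones] by (intro max_gain_le_gain_bound) auto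
    also have "\<dots> \<le> Max (?B ` ?S)"
      using fin that by (intro Max_ge) auto
    finally show ?thesis .
  qed
  moreover have "?B v \<le> Max (?M ` ?S)" if v: "v \<in> ?S" for v
  proof -
    obtain w k where w: "w \<subseteq> v" "w \<noteq> {}"
      "?B v \<le> gain_coeff b (b ^ m) (net_point b \<phi> m n C) w k"
      using gain_bound_le_some_gain_coeff[of v] u(1) v by blast
    note w(3)
    also have "gain_coeff b (b ^ m) (net_point b \<phi> m n C) w k \<le> ?M w"
      using w(1) v u(1) by (intro gain_coeff_le_max_gain) auto
    also have "\<dots> \<le> Max (?M ` ?S)"
      using fin w v by (intro Max_ge finite_imageI imageI) auto
    finally show ?thesis .
  qed
  ultimately have "Max (?M ` ?S) \<le> Max (?B ` ?S)" "Max (?B ` ?S) \<le> Max (?M ` ?S)"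
    using fin ne by (simp_all add: Max.bounded_iff del: mem_Collect_eq)
  then show ?thesis
    unfolding max_gain_star_def by (rule antisym)
qed

end

theorem theorem4p5:
  fixes b m n s :: nat
    and \<phi> :: "nat \<Rightarrow> 'a :: {field, finite}"
    and C :: "nat \<Rightarrow> 'a mat"
    and P :: "nat \<Rightarrow> nat \<Rightarrow> real"
  assumes "primepow b" and "CARD('a) = b"
    and "bij_betw \<phi> {0..<b} UNIV" and "\<phi> 0 = 0"
    and "m \<ge> 1" and "n \<ge> m" and "s \<ge> 1"
    and "\<And>j. j \<in> {1..s} \<Longrightarrow> C j \<in> carrier_mat n m"
    and "P = net_point b \<phi> m n C"
  shows "(\<forall>u. u \<noteq> {} \<and> u \<subseteq> {1..s} \<and> full_row_rank (stacked_mat m C u (\<lambda>_. 1)) \<longrightarrow>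
            max_gain b (b ^ m) P u \<le> gain_bound b m C u \<and>
            max_gain_star b (b ^ m) P u = Max (gain_bound b m C ` {v. v \<noteq> {} \<and> v \<subseteq> u})) \<and>
         (full_row_rank (stacked_mat m C {1..s} (\<lambda>_. 1)) \<longrightarrow>
            max_gain_total b (b ^ m) P s = Max (gain_bound b m C ` {u. u \<noteq> {} \<and> u \<subseteq> {1..s}}))"
proof -
  interpret digital_net b m n s \<phi> C
    using assms by unfold_locales auto
  note P = \<open>P = net_point b \<phi> m n C\<close>
  have part: "max_gain b (b ^ m) P u \<le> gain_bound b m C u \<and>
      max_gain_star b (b ^ m) P u = Max (gain_bound b m C ` {v. v \<noteq> {} \<and> v \<subseteq> u})"
    if "u \<noteq> {}" "u \<subseteq> {1..s}" "full_row_rank (stacked_mat m C u (\<lambda>_. 1))" for u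
    using that max_gain_le_gain_bound[of u] max_gain_star_eq[of u] full_row_rank_stacked_iff[of u]
    unfolding P by blast
  have total: "max_gain_total b (b ^ m) P s = max_gain_star b (b ^ m) P {1..s}"
    by (simp only: max_gain_total_def max_gain_star_def)
  have "{1..s} \<noteq> {}"
    using \<open>s \<ge> 1\<close> by simp
  then show ?thesis
    unfolding total using part by blast
qed

end
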